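(* Let $H=(V,E)$ be a connected graph with maximum degree $\Delta(H)\geq 5$. Let $k\geq 2$ and let $p_1\geq p_2\geq\cdots\geq p_{k-1}\geq 2$ and $p_k\geq 4$ be $k$ positive integers such that $\sum_{i=1}^k p_i=\Delta(H)-1+k$. For each $i\in\{1,\ldots,k-1\}$ let $\mathcal{G}_i$ be a collection of graphs, each with minimum degree at least $p_i-1$. If $H$ is $(K_{\Delta(H)+1}\setminus e)$-free, then there exists a partition $(V_1,V_2,\ldots,V_k)$ of $V(H)$ such that $H[V_1]$ is a maximum order $\mathcal{G}_1$-free induced subgraph of $H$, $H[V_i]$ is $\mathcal{G}_i$-free for each $2\leq i\leq k-1$, $\Delta(H[V_k])\leq p_k$, and either $H[V_k]$ is $K_{p_k}$-free or its $p_k$-cliques are disjoint.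
   Context: All graphs are finite, undirected and simple. $\Delta(\cdot)$ denotes the maximum degree, $H[W]$ the subgraph of $H$ induced on $W\subseteq V(H)$, and $K_n$ the complete graph on $n$ vertices; $K_n\setminus e$ is the graph obtained from $K_n$ by removing one edge. For a graph $G$, a graph is $G$-free if it contains no subgraph (not necessarily induced) isomorphic to $G$; for a family $\mathcal{G}$ of graphs, a graph is $\mathcal{G}$-free if it is $G$-free for every $G\in\mathcal{G}$. "$H[V_1]$ is a maximum order $\mathcal{G}$-free induced subgraph of $H$" means that $H[V_1]$ is $\mathcal{G}$-free and $|V_1|\geq |S|$ for every $S\subseteq V(H)$ with $H[S]$ $\mathcal{G}$-free. A $q$-clique of a graph is a complete subgraph on $q$ vertices; "its $q$-cliques are disjoint" means that any two distinct $q$-cliques have no common vertex. The sets in a partition may be empty. *)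

theory Defs
  imports "Graph_Theory.Graph_Theory"
begin

text \<open>
  Finite simple undirected graphs are the locale \<open>graph\<close> of the library: finite, loop-free, symmetric
  digraphs without parallel arcs, an edge being a pair of opposite arcs. Hence the degree of a
  vertex is its \<open>out_degree\<close>. The null graph is admitted by \<open>graph\<close>; its maximum and minimum degree
  are taken to be 0, so that a graph of positive minimum degree has a vertex.
\<close>

definition max_degree :: "('a, 'b) pre_digraph \<Rightarrow> nat" where
  "max_degree G = (if verts G = {} then 0 else Max (out_degree G ` verts G))"

definition min_degree :: "('a, 'b) pre_digraph \<Rightarrow> nat" where
  "min_degree G = (if verts G = {} then 0 else Min (out_degree G ` verts G))"

definition graph_free :: "('c, 'd) pre_digraph \<Rightarrow> ('a, 'b) pre_digraph \<Rightarrow> bool" where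
  "graph_free G H \<longleftrightarrow> \<not> (\<exists>H'. subgraph H' H \<and> digraph_iso G H')"

definition family_free :: "('c, 'd) pre_digraph set \<Rightarrow> ('a, 'b) pre_digraph \<Rightarrow> bool" where
  "family_free \<G> H \<longleftrightarrow> (\<forall>G\<in>\<G>. graph_free G H)"

definition maximum_family_free_induced ::
    "('c, 'd) pre_digraph set \<Rightarrow> ('a, 'b) pre_digraph \<Rightarrow> 'a set \<Rightarrow> bool" where
  "maximum_family_free_induced \<G> H W \<longleftrightarrow>
     W \<subseteq> verts H \<and> family_free \<G> (H \<restriction> W) \<and>
     (\<forall>S. S \<subseteq> verts H \<longrightarrow> family_free \<G> (H \<restriction> S) \<longrightarrow> card S \<le> card W)"

definition complete_graph :: "nat \<Rightarrow> nat pair_pre_digraph" where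
  "complete_graph n = \<lparr> pverts = {..<n}, parcs = {(i, j). i < n \<and> j < n \<and> i \<noteq> j} \<rparr>"

text \<open>All edges of a complete graph are equivalent under automorphisms, so the removed edge is fixed
  to be the one between 0 and 1 (for \<open>n \<ge> 2\<close>).\<close>

definition complete_graph_minus_edge :: "nat \<Rightarrow> nat pair_pre_digraph" where
  "complete_graph_minus_edge n =
     \<lparr> pverts = {..<n}, parcs = parcs (complete_graph n) - {(0, 1), (1, 0)} \<rparr>"

definition cliques :: "nat \<Rightarrow> ('a, 'b) pre_digraph \<Rightarrow> ('a, 'b) pre_digraph set" where
  "cliques q G = {C. subgraph C G \<and> K\<^bsub>q\<^esub> C}"

definition cliques_disjoint :: "nat \<Rightarrow> ('a, 'b) pre_digraph \<Rightarrow> bool" where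
  "cliques_disjoint q G \<longleftrightarrow>
     (\<forall>C\<in>cliques q G. \<forall>D\<in>cliques q G. C \<noteq> D \<longrightarrow> verts C \<inter> verts D = {})"

lemma complete_digraph_complete_graph: "K\<^bsub>n\<^esub> (with_proj (complete_graph n))"
  by (auto simp: complete_digraph_pair_def complete_graph_def)

end

theory Submission
  imports Defs
begin

text \<open>Write \<open>W\<close> for \<open>V k\<close>, \<open>q\<close> for \<open>p k\<close> and \<open>d i\<close> for \<open>p i - 1\<close>, so that \<open>q\<close> and the numbers \<open>d i\<close> for \<open>i < k\<close> add up
to the maximum degree of \<open>H\<close>. Choose the partition such that, in this order of priority, \<open>V 1\<close> is as
large as possible, \<open>W\<close> is as small as possible, \<open>W\<close> spans as few edges as possible, and a weighted count
of the \<open>q\<close>-cliques and of the copies of \<open>K\<^bsub>q+1\<^esub>\<close> minus an edge in \<open>W\<close> is as small as possible. A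
vertex of \<open>W\<close> has at least \<open>d i\<close> neighbours in every \<open>V i\<close>, since it could join \<open>V i\<close> otherwise. So it has
at most \<open>q\<close> neighbours in \<open>W\<close>, and with \<open>q\<close> of them it has exactly \<open>d i\<close> in each \<open>V i\<close>.

A vertex \<open>v\<close> of \<open>W\<close> is called tight if it has \<open>q\<close> neighbours in \<open>W\<close> and at most one pair of them is
nonadjacent. Two \<open>q\<close>-cliques of \<open>W\<close> that meet do so in a tight vertex (\<open>tight_of_meeting_cliques\<close>), so it
is enough to exclude tight vertices. The tool is exchange: a tight \<open>v\<close> can be exchanged with every vertex
\<open>z\<close> of its component in \<open>V i \<union> {v}\<close>; the partition remains optimal and \<open>z\<close> becomes tight
(\<open>component_exchange\<close>, \<open>tight_exchange\<close>). As \<open>q \<ge> 4\<close>, the neighbourhoods of tight vertices that occur in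
this way are equal or disjoint (\<open>almost_cliques_equal_or_disjoint\<close>). Hence \<open>z\<close> is either attached, that
is, its neighbours in \<open>W\<close> are exactly the closed neighbourhood \<open>D\<close> of \<open>v\<close>, or has at most the neighbour
\<open>v\<close> in \<open>D\<close> (\<open>attached_or_apart\<close>). The attached vertices of all classes form a clique together with \<open>D\<close>,
up to the one edge that \<open>D\<close> may miss. If every neighbour of \<open>v\<close> outside \<open>W\<close> were attached, \<open>H\<close> would
contain a complete graph on one vertex more than the maximum degree, minus an edge. So some class \<open>V i\<close>
has fewer than \<open>d i\<close> attached vertices (\<open>ex_colour_not_all_attached\<close>).

In this class, exchange \<open>v\<close> with a vertex \<open>z\<close> that is not attached, choose a new tight vertex \<open>v'\<close> in the
neighbourhood of \<open>z\<close>, and go on. With \<open>v\<close> moved away, its neighbourhood in \<open>W\<close> remains as a remnant, and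
one shows that the chain never returns to a remnant or to a component of \<open>V i\<close> that it has passed
(\<open>chain_step\<close>). So the remnants are all different, which is impossible in a finite graph.\<close>

section \<open>Almost cliques\<close>

locale simple_adjacency =
  fixes adj :: "'a \<Rightarrow> 'a \<Rightarrow> bool"
  assumes adj_sym: "adj x y \<Longrightarrow> adj y x"
    and adj_irrefl: "\<not> adj x x"
begin

definition nbrs :: "'a set \<Rightarrow> 'a \<Rightarrow> 'a set" where
  "nbrs S x = {y \<in> S. adj x y}"

definition clique :: "'a set \<Rightarrow> bool" where
  "clique S \<longleftrightarrow> (\<forall>x\<in>S. \<forall>y\<in>S. x \<noteq> y \<longrightarrow> adj x y)"

definition almost_clique :: "'a set \<Rightarrow> bool" where
  "almost_clique S \<longleftrightarrow> (\<exists>e. \<forall>x\<in>S. \<forall>y\<in>S. x \<noteq> y \<longrightarrow> \<not> adj x y \<longrightarrow> {x, y} = e)"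

definition universal :: "'a set \<Rightarrow> 'a \<Rightarrow> bool" where
  "universal S x \<longleftrightarrow> x \<in> S \<and> (\<forall>y\<in>S. y \<noteq> x \<longrightarrow> adj x y)"

lemma universal_in: "universal S x \<Longrightarrow> x \<in> S"
  by (simp add: universal_def)

lemma universal_adj: "universal S x \<Longrightarrow> y \<in> S \<Longrightarrow> y \<noteq> x \<Longrightarrow> adj x y"
  by (simp add: universal_def)

lemma adj_commute: "adj x y \<longleftrightarrow> adj y x"
  using adj_sym[of x y] adj_sym[of y x] by blast

lemma clique_insert: "clique (insert x S) \<longleftrightarrow> clique S \<and> (\<forall>y\<in>S. y \<noteq> x \<longrightarrow> adj x y)"
  unfolding clique_def by (metis adj_commute insert_iff)

lemma nbrs_subset: "nbrs S x \<subseteq> S"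
  by (auto simp: nbrs_def)

lemma nbrs_insert:
  "nbrs (insert y S) x = (if adj x y then insert y (nbrs S x) else nbrs S x)"
  by (auto simp: nbrs_def)

lemma nbrs_insert_self: "nbrs (insert x S) x = nbrs S x"
  by (simp add: nbrs_insert adj_irrefl)

lemma not_in_own_nbrs: "x \<notin> nbrs S x"
  by (simp add: nbrs_def adj_irrefl)

lemma almost_clique_subset: "almost_clique S \<Longrightarrow> S' \<subseteq> S \<Longrightarrow> almost_clique S'"
  unfolding almost_clique_def by (meson subsetD)

lemma clique_imp_almost_clique: "clique S \<Longrightarrow> almost_clique S"
  by (auto simp: clique_def almost_clique_def)

lemma almost_clique_nonedge_unique:
  "almost_clique S \<Longrightarrow> x \<in> S \<Longrightarrow> y \<in> S \<Longrightarrow> x \<noteq> y \<Longrightarrow> \<not> adj x y \<Longrightarrow>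
   x' \<in> S \<Longrightarrow> y' \<in> S \<Longrightarrow> x' \<noteq> y' \<Longrightarrow> \<not> adj x' y' \<Longrightarrow> {x, y} = {x', y'}"
  unfolding almost_clique_def by (erule exE) simp

lemma almost_cliqueI:
  assumes "\<And>x y x' y'. \<lbrakk>x \<in> S; y \<in> S; x \<noteq> y; \<not> adj x y; x' \<in> S; y' \<in> S; x' \<noteq> y'; \<not> adj x' y'\<rbrakk>
    \<Longrightarrow> {x, y} = {x', y'}"
  shows "almost_clique S"
proof (cases "clique S")
  case False
  then obtain a b where "a \<in> S" "b \<in> S" "a \<noteq> b" "\<not> adj a b" by (auto simp: clique_def)
  then show ?thesis unfolding almost_clique_def
    by (intro exI[of _ "{a, b}"] ballI impI assms) auto
qed (rule clique_imp_almost_clique)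

lemma almost_clique_insert_universal:
  assumes "almost_clique S" "\<And>y. y \<in> S \<Longrightarrow> adj x y"
  shows "almost_clique (insert x S)"
proof (rule almost_cliqueI)
  fix a b a' b'
  assume h: "a \<in> insert x S" "b \<in> insert x S" "a \<noteq> b" "\<not> adj a b"
    "a' \<in> insert x S" "b' \<in> insert x S" "a' \<noteq> b'" "\<not> adj a' b'"
  have "u \<in> S \<and> w \<in> S" if "u \<in> insert x S" "w \<in> insert x S" "u \<noteq> w" "\<not> adj u w" for u w
    using that assms(2)[of u] assms(2)[of w] adj_sym[of x u] by auto
  from this[OF h(1-4)] this[OF h(5-8)] show "{a, b} = {a', b'}" using almost_clique_nonedge_unique[OF assms(1), of a b a' b'] h by simp
qed

lemma almost_clique_universal:
  assumes "almost_clique T"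
  obtains a b where "\<And>x y. \<lbrakk>x \<in> T; x \<noteq> a; x \<noteq> b; y \<in> T; x \<noteq> y\<rbrakk> \<Longrightarrow> adj x y"
proof (cases "clique T")
  case False
  then obtain a b where ab: "a \<in> T" "b \<in> T" "a \<noteq> b" "\<not> adj a b" by (auto simp: clique_def)
  have "adj x y" if "x \<in> T" "x \<noteq> a" "x \<noteq> b" "y \<in> T" "x \<noteq> y" for x y
    using almost_clique_nonedge_unique[OF assms ab, of x y] that by auto
  then show ?thesis using that by blast
qed (use that in \<open>auto simp: clique_def\<close>)

lemma almost_clique_two_universal:
  assumes "almost_clique T" "card T \<ge> 4"
  obtains w w' where "universal T w" "universal T w'" "w \<noteq> w'"
proof -
  obtain a b where ab: "\<And>x y. \<lbrakk>x \<in> T; x \<noteq> a; x \<noteq> b; y \<in> T; x \<noteq> y\<rbrakk> \<Longrightarrow> adj x y"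
    using almost_clique_universal[OF assms(1)] by metis
  have fin: "finite T" using assms(2) by (metis card.infinite not_numeral_le_zero)
  have "card (T - {a, b}) \<ge> card T - card {a, b}" by (intro diff_card_le_card_Diff) auto
  moreover have "card {a, b} \<le> 2" by (simp add: card_insert_if)
  ultimately have "card (T - {a, b}) \<ge> 2" using assms(2) by linarith
  then obtain w w' where "w \<in> T - {a, b}" "w' \<in> T - {a, b}" "w \<noteq> w'"
    by (metis card_le_Suc0_iff_eq fin finite_Diff not_less_eq_eq numeral_2_eq_2)
  then have "universal T w" "universal T w'" using ab by (auto simp: universal_def)
  then show ?thesis using that \<open>w \<noteq> w'\<close> by blast
qed

text \<open>Two different \<open>q\<close>-sets that meet have a union of more than \<open>q\<close> vertices, in which a common vertex
has fewer than \<open>q\<close> neighbours; hence every common vertex \<open>y\<close> is nonadjacent to at least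
\<open>m = card (T' - T)\<close> vertices of \<open>T \<union> T'\<close>. The \<open>q - m\<close> common vertices thus produce
\<open>m * (q - m) \<ge> q - 1 \<ge> 3\<close> pairs \<open>(y, x)\<close>, whereas the at most one missing edge of each set accounts
for at most two: either the missing edge lies in \<open>T \<inter> T'\<close> and is then the same for both sets, or each
set has at most one end of its missing edge in the intersection.\<close>

lemma almost_cliques_equal_or_disjoint:
  assumes Y: "finite Y" "T \<subseteq> Y" "T' \<subseteq> Y" and q: "card T = q" "card T' = q" "q \<ge> 4"
    and ac: "almost_clique T" "almost_clique T'"
    and deg: "\<And>y. y \<in> T \<inter> T' \<Longrightarrow> card (nbrs Y y) < q"
  shows "T = T' \<or> T \<inter> T' = {}"
proof (rule ccontr)
  assume neg: "\<not> ?thesis"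
  have fin: "finite T" "finite T'" using Y finite_subset by auto
  let ?I = "T \<inter> T'"
  let ?m = "card (T' - T)"
  define non where "non y = {x \<in> T \<union> T'. x \<noteq> y \<and> \<not> adj y x}" for y
  define P where "P = Sigma ?I non"
  have fnon: "finite (non y)" for y using fin by (simp add: non_def)
  have "T' - T \<noteq> {}" using neg q fin by (metis Diff_eq_empty_iff card_subset_eq)
  then have m1: "?m \<ge> 1" using fin by (simp add: Suc_leI card_gt_0_iff)
  have un: "card (T \<union> T') = q + ?m"
    using q(1) fin card_Un_disjoint[of T "T' - T"] by simp
  have int: "card ?I + ?m = q"
    using q(2) fin card_Diff_subset_Int[of T' T] card_mono[of T' ?I] by (simp add: Int_commute)
  have I1: "card ?I \<ge> 1" using neg fin by (simp add: Suc_leI card_gt_0_iff)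
  have non: "card (non y) \<ge> ?m" if "y \<in> ?I" for y
  proof -
    have "T \<union> T' \<subseteq> insert y (non y \<union> nbrs Y y)"
      using Y by (auto simp: nbrs_def non_def)
    then have "card (T \<union> T') \<le> card (insert y (non y \<union> nbrs Y y))"
      using fnon Y(1) finite_subset[OF nbrs_subset Y(1)] by (intro card_mono) auto
    also have "\<dots> \<le> Suc (card (non y \<union> nbrs Y y))"
      using fnon Y(1) finite_subset[OF nbrs_subset Y(1)] by (simp add: card_insert_if)
    also have "\<dots> \<le> Suc (card (non y) + card (nbrs Y y))"
      using card_Un_le by auto
    finally show ?thesis using deg[OF that] un by linarith
  qed
  have "card ?I * ?m \<le> (\<Sum>y\<in>?I. card (non y))"
    using sum_bounded_below[of ?I "?m" "\<lambda>y. card (non y)"] non by simp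
  also have "\<dots> = card P"
    unfolding P_def using fin fnon by (subst card_SigmaI) auto
  finally have lower: "card ?I * ?m \<le> card P" .
  have upper: "card P \<le> 2"
  proof (cases "clique ?I")
    case False
    then obtain a b where ab: "a \<in> ?I" "b \<in> ?I" "a \<noteq> b" "\<not> adj a b" by (auto simp: clique_def)
    have "P \<subseteq> {(a, b), (b, a)}"
    proof
      fix p assume "p \<in> P"
      then obtain y x where yx: "p = (y, x)" "y \<in> ?I" "x \<in> T \<union> T'" "x \<noteq> y" "\<not> adj y x"
        by (auto simp: P_def non_def)
      have "{a, b} = {y, x}"
        using almost_clique_nonedge_unique[OF ac(1), of a b y x]
          almost_clique_nonedge_unique[OF ac(2), of a b y x] ab yx by auto
      then show "p \<in> {(a, b), (b, a)}" using yx(1) by (auto simp: doubleton_eq_iff)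
    qed
    then have "card P \<le> card {(a, b), (b, a)}" by (intro card_mono) auto
    then show ?thesis using ab(3) by simp
  next
    case True
    have one: "card {p \<in> P. snd p \<in> S} \<le> 1" if S: "almost_clique S" "?I \<subseteq> S" "finite S" for S
    proof -
      have "p = p'" if p: "p \<in> P" "snd p \<in> S" "p' \<in> P" "snd p' \<in> S" for p p'
      proof -
        obtain y x y' x' where yx: "p = (y, x)" "p' = (y', x')" by (metis surj_pair)
        have h: "y \<in> ?I" "y \<noteq> x" "\<not> adj y x" "y' \<in> ?I" "y' \<noteq> x'" "\<not> adj y' x'" "x \<in> S" "x' \<in> S"
          using p yx by (auto simp: P_def non_def)
        then have "{y, x} = {y', x'}" using S
          by (intro almost_clique_nonedge_unique[of S]) auto
        moreover have "\<not> (y = x' \<and> x = y')" using h True unfolding clique_def by blast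
        ultimately show ?thesis using yx by (auto simp: doubleton_eq_iff)
      qed
      moreover have "finite P" unfolding P_def using fin fnon by auto
      ultimately have "card {p \<in> P. snd p \<in> S} \<le> Suc 0"
        by (subst card_le_Suc0_iff_eq) auto
      then show ?thesis by simp
    qed
    have "P = {p \<in> P. snd p \<in> T} \<union> {p \<in> P. snd p \<in> T'}" by (auto simp: P_def non_def)
    then have "card P \<le> card {p \<in> P. snd p \<in> T} + card {p \<in> P. snd p \<in> T'}"
      by (metis (no_types, lifting) card_Un_le)
    then show ?thesis using one[of T] one[of T'] ac fin by fastforce
  qed
  have "q \<le> card ?I * ?m + 1"
  proof -
    obtain i j where "card ?I = Suc i" "?m = Suc j" using I1 m1 by (metis One_nat_def Suc_le_D)
    then show ?thesis using int by simp
  qed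
  then show False using lower upper q(3) by linarith
qed

end

section \<open>Counting cliques through a vertex\<close>

context simple_adjacency begin

text \<open>A tight vertex of \<open>W\<close> is one whose closed neighbourhood in \<open>W\<close> is a \<open>K\<^bsub>q+1\<^esub>\<close> or a \<open>K\<^bsub>q+1\<^esub>\<close> minus an edge
that misses the vertex. When degrees in \<open>W\<close> are at most \<open>q\<close>, tight vertices are what must be avoided to
keep the \<open>q\<close>-cliques disjoint.\<close>

definition tight :: "nat \<Rightarrow> 'a set \<Rightarrow> 'a \<Rightarrow> bool" where
  "tight q W v \<longleftrightarrow> v \<in> W \<and> card (nbrs W v) = q \<and> almost_clique (nbrs W v)"

text \<open>The score weighs the \<open>q\<close>-cliques against the induced copies of \<open>K\<^bsub>q+1\<^esub>\<close> minus an edge. With the weight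
\<open>q - 2\<close> a tight vertex contributes \<open>q\<close> in both of its forms, as \<open>q\<close> cliques or as \<open>2 + (q - 2)\<close>, and a
vertex of degree \<open>q\<close> that is not tight contributes less; in particular an end of the missing edge
contributes only \<open>1 + (q - 2)\<close>. A plain count of cliques would not treat the two forms alike.\<close>

definition clique_score :: "nat \<Rightarrow> 'a set \<Rightarrow> nat" where
  "clique_score q W = card {C. C \<subseteq> W \<and> card C = q \<and> clique C}
     + (q - 2) * card {D. D \<subseteq> W \<and> card D = q + 1 \<and> almost_clique D \<and> \<not> clique D}"

definition clique_gain :: "nat \<Rightarrow> 'a set \<Rightarrow> 'a \<Rightarrow> nat" where
  "clique_gain q Y x = card {B. B \<subseteq> Y \<and> card B = q - 1 \<and> clique (insert x B)}
     + (q - 2) * card {B. B \<subseteq> Y \<and> card B = q \<and> almost_clique (insert x B) \<and> \<not> clique (insert x B)}"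

lemma card_subsets_insert:
  assumes "finite Y" "x \<notin> Y" "m > 0"
  shows "card {C. C \<subseteq> insert x Y \<and> card C = m \<and> P C} =
    card {C. C \<subseteq> Y \<and> card C = m \<and> P C} + card {B. B \<subseteq> Y \<and> card B = m - 1 \<and> P (insert x B)}"
proof -
  let ?N = "{B. B \<subseteq> Y \<and> card B = m - 1 \<and> P (insert x B)}"
  have finB: "finite B" if "B \<subseteq> Y" for B using that assms(1) finite_subset by blast
  have "{C. C \<subseteq> insert x Y \<and> card C = m \<and> P C} = {C. C \<subseteq> Y \<and> card C = m \<and> P C} \<union> insert x ` ?N"
  proof (intro equalityI subsetI)
    fix C assume C: "C \<in> {C. C \<subseteq> insert x Y \<and> card C = m \<and> P C}"
    show "C \<in> {C. C \<subseteq> Y \<and> card C = m \<and> P C} \<union> insert x ` ?N"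
    proof (cases "x \<in> C")
      case True
      then have "C = insert x (C - {x})" "C - {x} \<subseteq> Y" using C by auto
      moreover have "card (C - {x}) = m - 1" using C True by simp
      ultimately have "C - {x} \<in> ?N" using C by auto
      then show ?thesis using \<open>C = insert x (C - {x})\<close> by blast
    qed (use C in auto)
  next
    fix C assume "C \<in> {C. C \<subseteq> Y \<and> card C = m \<and> P C} \<union> insert x ` ?N"
    then show "C \<in> {C. C \<subseteq> insert x Y \<and> card C = m \<and> P C}"
    proof
      assume "C \<in> insert x ` ?N"
      then obtain B where B: "C = insert x B" "B \<subseteq> Y" "card B = m - 1" "P C" by auto
      moreover have "x \<notin> B" using B(2) assms(2) by blast
      ultimately have "card C = m" using finB assms(3) by simp
      then show ?thesis using B by auto
    qed auto
  qed
  moreover have "card (insert x ` ?N) = card ?N"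
  proof (intro card_image inj_onI)
    fix B B' assume h: "B \<in> ?N" "B' \<in> ?N" "insert x B = insert x B'"
    then have "x \<notin> B" "x \<notin> B'" using assms(2) by auto
    then show "B = B'" using h(3) by (metis Diff_insert_absorb)
  qed
  moreover have "finite ?N" by (rule finite_subset[of _ "Pow Y"]) (use assms in auto)
  moreover have "finite {C. C \<subseteq> Y \<and> card C = m \<and> P C}"
    by (rule finite_subset[of _ "Pow Y"]) (use assms in auto)
  moreover have "{C. C \<subseteq> Y \<and> card C = m \<and> P C} \<inter> insert x ` ?N = {}" using assms(2) by auto
  ultimately show ?thesis using card_Un_disjoint[of "{C. C \<subseteq> Y \<and> card C = m \<and> P C}" "insert x ` ?N"] by auto
qed

lemma clique_score_insert:
  assumes "finite Y" "x \<notin> Y" "q > 0"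
  shows "clique_score q (insert x Y) = clique_score q Y + clique_gain q Y x"
  using card_subsets_insert[OF assms(1,2), of q clique] assms(3)
    card_subsets_insert[OF assms(1,2), of "q + 1" "\<lambda>D. almost_clique D \<and> \<not> clique D"]
  by (simp add: clique_score_def clique_gain_def algebra_simps)

lemma subset_one_less:
  assumes "finite N" "card N = q" "B \<subseteq> N" "card B = q - 1" "q > 0"
  obtains y where "y \<in> N" "B = N - {y}"
proof -
  have "card (N - B) = 1" using assms card_Diff_subset[of B N] finite_subset[of B N] by simp
  then obtain y where y: "N - B = {y}" by (metis card_1_singletonE)
  then have "y \<in> N" "B = N - {y}" using assms(3) by auto
  then show ?thesis using that by blast
qed

text \<open>A vertex \<open>x\<close> outside \<open>Y\<close> with \<open>q\<close> neighbours in \<open>Y\<close> is added, and all degrees stay at most \<open>q\<close>.\<close>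

context
  fixes q :: nat and Y :: "'a set" and x :: 'a
  assumes Y: "finite Y" "x \<notin> Y" and q4: "q \<ge> 4"
    and deg: "card (nbrs Y x) = q"
    and deg_less: "\<And>y. y \<in> nbrs Y x \<Longrightarrow> card (nbrs Y y) < q"
begin

abbreviation (input) "N \<equiv> nbrs Y x"
abbreviation (input) "through_cliques \<equiv> {B. B \<subseteq> Y \<and> card B = q - 1 \<and> clique (insert x B)}"
abbreviation (input) "through_minus_edge \<equiv> {B. B \<subseteq> Y \<and> card B = q \<and> almost_clique (insert x B) \<and> \<not> clique (insert x B)}"

lemma finite_N: "finite N" using Y nbrs_subset finite_subset by blast

lemma through_cliques_eq: "through_cliques = {B. \<exists>y\<in>N. B = N - {y} \<and> clique B}"
proof (intro equalityI subsetI)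
  fix B assume B: "B \<in> through_cliques"
  then have "B \<subseteq> N" using Y(2) by (auto simp: nbrs_def clique_def)
  then obtain y where "y \<in> N" "B = N - {y}" using subset_one_less[OF finite_N deg, of B] B q4 by auto
  moreover have "clique B" using B by (auto simp: clique_def)
  ultimately show "B \<in> {B. \<exists>y\<in>N. B = N - {y} \<and> clique B}" by blast
next
  fix B assume "B \<in> {B. \<exists>y\<in>N. B = N - {y} \<and> clique B}"
  then obtain y where y: "y \<in> N" "B = N - {y}" "clique B" by blast
  then have "card B = q - 1" using deg finite_N by simp
  moreover have "clique (insert x B)" using y by (auto simp: clique_insert nbrs_def)
  ultimately show "B \<in> through_cliques" using y by (auto simp: nbrs_def)
qed

text \<open>A copy of \<open>K\<^bsub>q+1\<^esub>\<close> minus an edge through \<open>x\<close> that is not the closed neighbourhood of \<open>x\<close> contains a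
non-neighbour \<open>b\<close> of \<open>x\<close>, so \<open>{x, b}\<close> is its missing edge.\<close>

lemma through_minus_edge_cases:
  assumes "B \<in> through_minus_edge" "B \<noteq> N"
  obtains y b where "y \<in> N" "b \<in> Y - N" "B = insert b (N - {y})" "clique B"
proof -
  have fB: "finite B" using assms(1) Y finite_subset by blast
  have "\<not> B \<subseteq> N" using assms deg finite_N card_subset_eq[of N B] by auto
  then obtain b where b: "b \<in> B" "b \<notin> N" by blast
  have bY: "b \<in> Y" "b \<noteq> x" "\<not> adj x b" using b assms(1) Y(2) by (auto simp: nbrs_def)
  have only: "{x, b} = {u, w}" if "u \<in> insert x B" "w \<in> insert x B" "u \<noteq> w" "\<not> adj u w" for u w
    using almost_clique_nonedge_unique[of "insert x B" x b u w] assms(1) b bY that by auto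
  have "B - {b} \<subseteq> N"
  proof
    fix c assume c: "c \<in> B - {b}"
    then have "c \<noteq> x" using assms(1) Y(2) by auto
    then have "adj x c" using only[of x c] c by (auto simp: doubleton_eq_iff)
    then show "c \<in> N" using c assms(1) by (auto simp: nbrs_def)
  qed
  moreover have "card (B - {b}) = q - 1" using assms(1) b fB by simp
  ultimately obtain y where y: "y \<in> N" "B - {b} = N - {y}" using subset_one_less[OF finite_N deg, of "B - {b}"] q4 by auto
  have "x \<notin> B" using assms(1) Y(2) by auto
  then have "clique B" unfolding clique_def using only by (metis doubleton_eq_iff insertCI)
  moreover have "B = insert b (N - {y})" using y b(1) by auto
  ultimately show ?thesis using that y b bY by blast
qed

text \<open>No copy of \<open>K\<^bsub>q+1\<^esub>\<close> minus an edge other than the closed neighbourhood of \<open>x\<close> contributes: its vertex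
outside \<open>N\<close> would give a universal vertex of \<open>N\<close> too many neighbours.\<close>

lemma clique_gain_tight:
  assumes "almost_clique N"
  shows "clique_gain q Y x = q"
proof -
  have "card N \<ge> 4" using deg q4 by simp
  then obtain w w' where w: "universal N w" "universal N w'" "w \<noteq> w'"
    using almost_clique_two_universal[OF assms] by blast
  have only: "B = N" if B: "B \<in> through_minus_edge" for B
  proof (rule ccontr)
    assume "B \<noteq> N"
    then obtain y b where yb: "y \<in> N" "b \<in> Y - N" "B = insert b (N - {y})" "clique B"
      using through_minus_edge_cases[OF B] by metis
    obtain c where "universal N c" "c \<noteq> y" using w by blast
    then have c: "c \<in> N - {y}" "\<And>z. z \<in> N \<Longrightarrow> z \<noteq> c \<Longrightarrow> adj c z"
      by (auto simp: universal_def)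
    then have "adj c b" using yb by (auto simp: clique_def)
    then have "insert b (N - {c}) \<subseteq> nbrs Y c" using c yb(2) by (auto simp: nbrs_def)
    then have "card (insert b (N - {c})) \<le> card (nbrs Y c)" using Y nbrs_subset
      by (metis card_mono finite_subset)
    moreover have "card (insert b (N - {c})) = q" using yb(2) c(1) finite_N deg q4 by simp
    ultimately show False using deg_less[of c] c(1) by auto
  qed
  show ?thesis
  proof (cases "clique N")
    case True
    have "clique (insert x N)" using True by (auto simp: clique_insert nbrs_def)
    then have "through_minus_edge = {}" using only by auto
    moreover have "through_cliques = (\<lambda>y. N - {y}) ` N" unfolding through_cliques_eq using True by (auto simp: clique_def)
    moreover have "inj_on (\<lambda>y. N - {y}) N" by (rule inj_onI) blast
    ultimately show ?thesis unfolding clique_gain_def using deg by (simp only: card_image card.empty)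
  next
    case False
    then obtain a b where ab: "a \<in> N" "b \<in> N" "a \<noteq> b" "\<not> adj a b" by (auto simp: clique_def)
    have cl: "clique (N - {y})" if y: "y = a \<or> y = b" for y
      unfolding clique_def
    proof (intro ballI impI, rule ccontr)
      fix u z assume h: "u \<in> N - {y}" "z \<in> N - {y}" "u \<noteq> z" "\<not> adj u z"
      then have "{a, b} = {u, z}" using almost_clique_nonedge_unique[OF assms ab, of u z] by auto
      then show False using h y by auto
    qed
    have no: "\<not> clique (N - {y})" if "y \<noteq> a" "y \<noteq> b" for y
      using that ab unfolding clique_def by blast
    have "through_cliques = {N - {a}, N - {b}}" unfolding through_cliques_eq using cl no ab by auto
    moreover have "N - {a} \<noteq> N - {b}" using ab by blast
    ultimately have "card through_cliques = 2" by simp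
    moreover have "N \<in> through_minus_edge"
    proof -
      have "almost_clique (insert x N)"
        by (rule almost_clique_insert_universal[OF assms]) (auto simp: nbrs_def)
      then show ?thesis using deg nbrs_subset False by (auto simp: clique_def)
    qed
    then have "through_minus_edge = {N}" using only by blast
    ultimately show ?thesis unfolding clique_gain_def using q4 by simp
  qed
qed

text \<open>If \<open>N\<close> misses two edges, at most one vertex of \<open>N\<close> meets them all, so at most one \<open>q\<close>-clique contains
\<open>x\<close>. Its vertices in \<open>N\<close> have room for only one further neighbour, so at most one copy of \<open>K\<^bsub>q+1\<^esub>\<close>
minus an edge contains \<open>x\<close>.\<close>

lemma clique_gain_not_tight:
  assumes "\<not> almost_clique N"
  shows "clique_gain q Y x < q"
proof -
  have uniq: "y = y'" if y: "y \<in> N" "clique (N - {y})" "y' \<in> N" "clique (N - {y'})" for y y'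
  proof (rule ccontr)
    assume ne: "y \<noteq> y'"
    have pair: "{u, z} = {y, y'}" if "u \<in> N" "z \<in> N" "u \<noteq> z" "\<not> adj u z" for u z
    proof -
      have "y \<in> {u, z}" "y' \<in> {u, z}" using y that unfolding clique_def by blast+
      then show ?thesis using ne by auto
    qed
    have "almost_clique N" unfolding almost_clique_def
      by (intro exI[of _ "{y, y'}"] ballI impI pair)
    then show False using assms by simp
  qed
  have QMN: "B \<noteq> N" if "B \<in> through_minus_edge" for B
    using that assms almost_clique_subset[of "insert x B" B] by auto
  have QC1: "card through_cliques \<le> 1"
  proof -
    have "through_cliques \<subseteq> Pow Y" by blast
    then have "finite through_cliques" using Y(1) finite_subset by blast
    moreover have "\<forall>B\<in>through_cliques. \<forall>B'\<in>through_cliques. B = B'" unfolding through_cliques_eq using uniq by blast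
    ultimately show ?thesis using card_le_Suc0_iff_eq[of through_cliques] by simp
  qed
  have QM1: "card through_minus_edge \<le> 1"
  proof -
    have "B = B'" if B: "B \<in> through_minus_edge" "B' \<in> through_minus_edge" for B B'
    proof -
      obtain y b where yb: "y \<in> N" "b \<in> Y - N" "B = insert b (N - {y})" "clique B"
        using through_minus_edge_cases[OF B(1) QMN[OF B(1)]] by metis
      obtain y' b' where yb': "y' \<in> N" "b' \<in> Y - N" "B' = insert b' (N - {y'})" "clique B'"
        using through_minus_edge_cases[OF B(2) QMN[OF B(2)]] by metis
      have "clique (N - {y})" "clique (N - {y'})" using yb yb' by (auto simp: clique_def)
      then have yy: "y' = y" using uniq yb yb' by blast
      have "card (N - {y}) > 0" using yb deg finite_N q4 by simp
      then obtain c where c: "c \<in> N - {y}" by (metis all_not_in_conv card.empty less_nat_zero_code)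
      have "b = b'"
      proof (rule ccontr)
        assume "b \<noteq> b'"
        have "adj c b" "adj c b'" "\<And>z. z \<in> N - {y} - {c} \<Longrightarrow> adj c z"
          using c yb yb' yy by (auto simp: clique_def)
        then have "insert b (insert b' (N - {y} - {c})) \<subseteq> nbrs Y c"
          using yb(2) yb'(2) by (auto simp: nbrs_def)
        then have "card (insert b (insert b' (N - {y} - {c}))) \<le> card (nbrs Y c)" using Y nbrs_subset
          by (metis card_mono finite_subset)
        moreover have "card (insert b (insert b' (N - {y} - {c}))) = q"
          using yb(1,2) yb'(2) c finite_N deg q4 \<open>b \<noteq> b'\<close> by simp
        ultimately show False using deg_less[of c] c by auto
      qed
      then show ?thesis using yb(3) yb'(3) yy by simp
    qed
    moreover have "finite through_minus_edge" by (rule finite_subset[of _ "Pow Y"]) (use Y in auto)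
    ultimately show ?thesis using card_le_Suc0_iff_eq[of through_minus_edge] by simp
  qed
  have "(q - 2) * card through_minus_edge \<le> (q - 2) * 1" using QM1 by (rule mult_le_mono2)
  then show ?thesis unfolding clique_gain_def using QC1 q4 by linarith
qed

end

lemma tight_universal_nbr:
  assumes fin: "finite W" and deg: "\<And>y. y \<in> W \<Longrightarrow> card (nbrs W y) \<le> q"
    and v: "tight q W v" and w: "universal (nbrs W v) w"
  shows "tight q W w" "insert w (nbrs W w) = insert v (nbrs W v)"
proof -
  let ?D = "insert v (nbrs W v)"
  have fn: "finite (nbrs W z)" for z using fin nbrs_subset finite_subset by blast
  have wN: "w \<in> nbrs W v" using w by (rule universal_in)
  then have wW: "w \<in> W" "adj v w" by (auto simp: nbrs_def)
  have sub: "?D - {w} \<subseteq> nbrs W w"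
    using universal_adj[OF w] wW v adj_commute[of w v] by (auto simp: nbrs_def tight_def)
  have c: "card (?D - {w}) = q" using wN fn v not_in_own_nbrs[of v W] by (simp add: tight_def)
  have eq: "nbrs W w = ?D - {w}" using card_subset_eq[OF fn sub] c deg[OF wW(1)] card_mono[OF fn sub] by simp
  then show "insert w (nbrs W w) = ?D" using wN by auto
  have "almost_clique ?D" using v by (intro almost_clique_insert_universal) (auto simp: tight_def nbrs_def)
  then have "almost_clique (nbrs W w)" using almost_clique_subset eq by blast
  then show "tight q W w" using wW c eq by (simp add: tight_def)
qed

end

context simple_adjacency begin

definition degree_sum :: "'a set \<Rightarrow> nat" where
  "degree_sum W = (\<Sum>x\<in>W. card (nbrs W x))"

lemma degree_sum_insert:
  assumes Y: "finite Y" "x \<notin> Y"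
  shows "degree_sum (insert x Y) = degree_sum Y + 2 * card (nbrs Y x)"
proof -
  have "(\<Sum>y\<in>Y. card (nbrs (insert x Y) y)) = (\<Sum>y\<in>Y. card (nbrs Y y) + (if adj x y then 1 else 0))"
  proof (rule sum.cong[OF refl])
    fix y
    have "x \<notin> nbrs Y y" "finite (nbrs Y y)" using Y by (auto simp: nbrs_def)
    then show "card (nbrs (insert x Y) y) = card (nbrs Y y) + (if adj x y then 1 else 0)"
      by (simp add: nbrs_insert adj_commute[of y x])
  qed
  also have "\<dots> = degree_sum Y + card (nbrs Y x)"
    using Y(1) by (simp add: sum.distrib degree_sum_def nbrs_def sum.If_cases Int_def)
  finally show ?thesis using Y by (simp add: degree_sum_def nbrs_insert_self)
qed

end

section \<open>Connectivity within a vertex set\<close>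

context simple_adjacency begin

definition arcs_within :: "'a set \<Rightarrow> ('a \<times> 'a) set" where
  "arcs_within X = {(x, y). x \<in> X \<and> y \<in> X \<and> adj x y}"

definition conn :: "'a set \<Rightarrow> 'a \<Rightarrow> 'a \<Rightarrow> bool" where
  "conn X x y \<longleftrightarrow> (x, y) \<in> (arcs_within X)\<^sup>*"

lemma conn_refl: "conn X x x" by (simp add: conn_def)

lemma conn_trans: "conn X x y \<Longrightarrow> conn X y z \<Longrightarrow> conn X x z"
  by (simp add: conn_def)

lemma conn_step: "conn X x y \<Longrightarrow> y \<in> X \<Longrightarrow> z \<in> X \<Longrightarrow> adj y z \<Longrightarrow> conn X x z"
  unfolding conn_def by (rule rtrancl_into_rtrancl) (auto simp: arcs_within_def)

lemma conn_edge: "x \<in> X \<Longrightarrow> y \<in> X \<Longrightarrow> adj x y \<Longrightarrow> conn X x y"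
  using conn_step conn_refl by blast

lemma conn_sym: "conn X x y \<Longrightarrow> conn X y x"
proof -
  have "sym (arcs_within X)" by (auto simp: arcs_within_def intro!: symI adj_sym)
  then show "conn X x y \<Longrightarrow> conn X y x" unfolding conn_def using sym_rtrancl symD by metis
qed

lemma conn_mono: "conn X x y \<Longrightarrow> X \<subseteq> X' \<Longrightarrow> conn X' x y"
  unfolding conn_def using rtrancl_mono[of "arcs_within X" "arcs_within X'"]
  by (auto simp: arcs_within_def)

lemma conn_induct [consumes 1, case_names refl step]:
  assumes "conn X x y" "P x"
    "\<And>y z. \<lbrakk>conn X x y; P y; y \<in> X; z \<in> X; adj y z\<rbrakk> \<Longrightarrow> P z"
  shows "P y"
  using assms(1) unfolding conn_def
proof (induction rule: rtrancl_induct)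
  case (step y z)
  then show ?case using assms(3)[of y z] by (auto simp: conn_def arcs_within_def)
qed (rule assms(2))

lemma conn_in: "conn X x y \<Longrightarrow> x \<in> X \<Longrightarrow> y \<in> X"
  by (induction rule: conn_induct) auto

lemma conn_closed:
  assumes "conn X x y" "x \<in> C" "\<And>a b. \<lbrakk>a \<in> C; a \<in> X; b \<in> X; adj a b\<rbrakk> \<Longrightarrow> b \<in> C"
  shows "conn (X \<inter> C) x y \<and> y \<in> C"
  using assms(1,2)
proof (induction rule: conn_induct)
  case (step y z)
  then show ?case using assms(3)[of y z] conn_step[of "X \<inter> C" x y z] by auto
qed (simp add: conn_refl)

lemma conn_avoid:
  assumes "\<not> conn (X - {z}) v y" "conn (X - {z}) v a"
  shows "conn (X - {y}) v a"
proof -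
  let ?C = "{b. conn (X - {z}) v b}"
  have "conn ((X - {z}) \<inter> ?C) v a"
    using assms(2) by (rule conn_closed[THEN conjunct1]) (auto intro: conn_refl conn_step)
  moreover have "(X - {z}) \<inter> ?C \<subseteq> X - {y}" using assms(1) by auto
  ultimately show ?thesis by (rule conn_mono)
qed

text \<open>A path from \<open>v\<close> to \<open>z\<close> stays, until it reaches \<open>z\<close>, among the vertices connected to \<open>v\<close> in
\<open>X - {z}\<close>, and \<open>y\<close> is not one of them.\<close>

lemma conn_avoid_swap:
  assumes "\<not> conn (X - {z}) v y" "conn X v z" "v \<in> X" "v \<noteq> z" "y \<noteq> z"
  shows "conn (X - {y}) v z"
proof (rule ccontr)
  assume neg: "\<not> ?thesis"
  have "conn (X - {z}) v b" if "conn X v b" for b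
    using that
  proof (induction rule: conn_induct)
    case refl
    then show ?case by (rule conn_refl)
  next
    case (step a b)
    have a: "a \<in> X - {z}" "a \<noteq> y" using conn_in[OF step.IH] assms step.IH by auto
    have ca: "conn (X - {y}) v a" by (rule conn_avoid[OF assms(1) step.IH])
    have "b \<noteq> z"
      using conn_step[OF ca, of z] a step.hyps assms(5) neg by auto
    then show ?case using conn_step[OF step.IH a(1), of b] step.hyps by simp
  qed
  then have "conn (X - {z}) v z" using assms(2) by blast
  then show False using conn_in[of "X - {z}" v z] assms(3,4) by simp
qed

end

section \<open>Optimal partitions and exchanges\<close>

text \<open>The parts to be found are \<open>V s\<close> for \<open>s \<in> I\<close>, to be free in the sense of \<open>free s\<close>, and the remaining
vertices \<open>rest V\<close>. Freeness enters only through three properties: the empty set is free, subsets of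
free sets are free, and adding a vertex with fewer than \<open>d s\<close> neighbours preserves freeness. The
last one is where minimum degree at least \<open>d s\<close> of the forbidden graphs is used. The colour \<open>r\<close> is the
one whose class is to be of maximum size.\<close>

locale free_partitions = simple_adjacency adj
  for adj :: "'a \<Rightarrow> 'a \<Rightarrow> bool" +
  fixes VV :: "'a set" and I :: "'i set" and r :: 'i and d :: "'i \<Rightarrow> nat"
    and free :: "'i \<Rightarrow> 'a set \<Rightarrow> bool" and q :: nat
  assumes finite_VV: "finite VV" and finite_I: "finite I" and r_in: "r \<in> I"
    and free_empty: "s \<in> I \<Longrightarrow> free s {}"
    and free_subset: "s \<in> I \<Longrightarrow> S \<subseteq> VV \<Longrightarrow> free s S \<Longrightarrow> S' \<subseteq> S \<Longrightarrow> free s S'"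
    and free_insert: "s \<in> I \<Longrightarrow> S \<subseteq> VV \<Longrightarrow> free s S \<Longrightarrow> x \<in> VV \<Longrightarrow> card (nbrs S x) < d s \<Longrightarrow>
      free s (insert x S)"
    and q4: "q \<ge> 4"
    and degree_bound: "x \<in> VV \<Longrightarrow> card (nbrs VV x) \<le> q + (\<Sum>s\<in>I. d s)"
    and no_almost_clique: "B \<subseteq> VV \<Longrightarrow> card B = q + (\<Sum>s\<in>I. d s) + 1 \<Longrightarrow> \<not> almost_clique B"
begin

definition rest :: "('i \<Rightarrow> 'a set) \<Rightarrow> 'a set" where
  "rest V = VV - (\<Union>s\<in>I. V s)"

definition valid :: "('i \<Rightarrow> 'a set) \<Rightarrow> bool" where
  "valid V \<longleftrightarrow> disjoint_family_on V I \<and> (\<forall>s\<in>I. V s \<subseteq> VV \<and> free s (V s))"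

text \<open>The three levels of optimality minimise lexicographically. The sizes force many neighbours in the free
classes, the number of edges inside \<open>rest V\<close> makes exchanges preserve the degree \<open>q\<close>, and the clique
score makes them preserve tightness.\<close>

definition size_optimal :: "('i \<Rightarrow> 'a set) \<Rightarrow> bool" where
  "size_optimal V \<longleftrightarrow> valid V \<and> (\<forall>V'. valid V' \<longrightarrow> card (V' r) \<le> card (V r)) \<and>
     (\<forall>V'. valid V' \<longrightarrow> card (V' r) = card (V r) \<longrightarrow> card (rest V) \<le> card (rest V'))"

definition edge_optimal :: "('i \<Rightarrow> 'a set) \<Rightarrow> bool" where
  "edge_optimal V \<longleftrightarrow> size_optimal V \<and>
     (\<forall>V'. size_optimal V' \<longrightarrow> degree_sum (rest V) \<le> degree_sum (rest V'))"

definition optimal :: "('i \<Rightarrow> 'a set) \<Rightarrow> bool" where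
  "optimal V \<longleftrightarrow> edge_optimal V \<and>
     (\<forall>V'. edge_optimal V' \<longrightarrow> clique_score q (rest V) \<le> clique_score q (rest V'))"

definition exchange :: "('i \<Rightarrow> 'a set) \<Rightarrow> 'i \<Rightarrow> 'a \<Rightarrow> 'a \<Rightarrow> 'i \<Rightarrow> 'a set" where
  "exchange V s v z = V(s := insert v (V s) - {z})"

lemma ex_optimal: "\<exists>V. optimal V"
proof -
  have "valid (\<lambda>_. {})" using free_empty by (auto simp: valid_def disjoint_family_on_def)
  moreover have "card (V r) \<le> card VV" if "valid V" for V
    using that r_in finite_VV card_mono[of VV "V r"] by (auto simp: valid_def)
  ultimately obtain V0 where V0: "valid V0" "\<And>V'. valid V' \<Longrightarrow> card (V' r) \<le> card (V0 r)"
    using ex_has_greatest_nat[of valid "\<lambda>_. {}" "\<lambda>V. card (V r)" "Suc (card VV)"] by (metis le_imp_less_Suc)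
  obtain V1 where V1: "valid V1 \<and> card (V1 r) = card (V0 r)"
    "\<And>V'. valid V' \<and> card (V' r) = card (V0 r) \<Longrightarrow> card (rest V1) \<le> card (rest V')"
    using ex_has_least_nat[of "\<lambda>V. valid V \<and> card (V r) = card (V0 r)" V0 "\<lambda>V. card (rest V)"] V0(1) by blast
  then have "size_optimal V1" using V0(2) by (auto simp: size_optimal_def)
  then obtain V2 where "edge_optimal V2"
    using ex_has_least_nat[of size_optimal V1 "\<lambda>V. degree_sum (rest V)"]
    unfolding edge_optimal_def by blast
  then show ?thesis
    using ex_has_least_nat[of edge_optimal V2 "\<lambda>V. clique_score q (rest V)"]
    unfolding optimal_def by blast
qed

lemma finite_rest: "finite (rest V)"
  using finite_VV by (simp add: rest_def)

lemma finite_class: "valid V \<Longrightarrow> s \<in> I \<Longrightarrow> finite (V s)"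
  using finite_VV finite_subset by (auto simp: valid_def)

lemma finite_nbrs: "finite S \<Longrightarrow> finite (nbrs S x)"
  using nbrs_subset finite_subset by blast

lemma rest_not_in: "v \<in> rest V \<Longrightarrow> s \<in> I \<Longrightarrow> v \<notin> V s"
  by (auto simp: rest_def)

lemma valid_update:
  assumes "valid V" "s \<in> I" "S \<subseteq> V s \<union> rest V" "free s S"
  shows "valid (V(s := S))"
proof -
  have "rest V \<inter> V t = {}" if "t \<in> I" for t using that by (auto simp: rest_def)
  moreover have "V s \<inter> V t = {}" if "t \<in> I" "t \<noteq> s" for t
    using that assms(1,2) by (auto simp: valid_def disjoint_family_on_def)
  ultimately have "S \<inter> V t = {}" if "t \<in> I" "t \<noteq> s" for t
    using that assms(3) by blast
  moreover have "S \<subseteq> VV" using assms(1-3) by (auto simp: valid_def rest_def)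
  ultimately show ?thesis using assms(1,2,4)
    by (auto simp: valid_def disjoint_family_on_def Int_commute)
qed

lemma valid_exchange:
  assumes "valid V" "s \<in> I" "v \<in> rest V" "z \<in> insert v (V s)" "free s (insert v (V s) - {z})"
  shows "valid (exchange V s v z)" "rest (exchange V s v z) = insert z (rest V - {v})"
    "card (exchange V s v z t) = card (V t)" "card (rest (exchange V s v z)) = card (rest V)"
proof -
  show "valid (exchange V s v z)" unfolding exchange_def
    by (rule valid_update[OF assms(1,2) _ assms(5)]) (use assms(3) in auto)
  have dis: "V t \<inter> V s = {}" if "t \<in> I" "t \<noteq> s" for t
    using assms(1,2) that by (auto simp: valid_def disjoint_family_on_def)
  have v: "v \<in> VV" "v \<notin> V s" using assms(2,3) by (auto simp: rest_def)
  have Vs: "V s \<subseteq> VV" using assms by (auto simp: valid_def)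
  have un: "(\<Union>t\<in>I. V t) = V s \<union> (\<Union>t\<in>I - {s}. V t)" using assms(2) by auto
  have un': "(\<Union>t\<in>I. exchange V s v z t) = (insert v (V s) - {z}) \<union> (\<Union>t\<in>I - {s}. V t)"
    using assms(2) by (auto simp: exchange_def)
  have z: "z \<notin> (\<Union>t\<in>I - {s}. V t)" using assms(2-4) dis by (auto simp: rest_def)
  show r: "rest (exchange V s v z) = insert z (rest V - {v})"
    using z assms(4) v Vs unfolding rest_def un un' by auto
  show "card (exchange V s v z t) = card (V t)"
    using finite_class[OF assms(1,2)] v assms(4) by (auto simp: exchange_def)
  have "z \<notin> rest V - {v}" using assms(2,4) by (auto simp: rest_def)
  then have "card (insert z (rest V - {v})) = Suc (card (rest V - {v}))"
    using finite_rest by (intro card_insert_disjoint) auto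
  then show "card (rest (exchange V s v z)) = card (rest V)"
    unfolding r using card_Suc_Diff1[OF finite_rest assms(3)] by simp
qed

lemma size_optimal_exchange:
  assumes "size_optimal V" "s \<in> I" "v \<in> rest V" "z \<in> insert v (V s)" "free s (insert v (V s) - {z})"
  shows "size_optimal (exchange V s v z)"
  using assms(1) valid_exchange[of V s v z] assms(2-) unfolding size_optimal_def by simp

text \<open>Otherwise \<open>x\<close> could join the class \<open>s\<close>, which would enlarge the class \<open>r\<close> or shrink the rest.\<close>

lemma class_degree_ge:
  assumes opt: "size_optimal V" and s: "s \<in> I" and x: "x \<in> rest V"
  shows "d s \<le> card (nbrs (V s) x)"
proof (rule ccontr)
  assume "\<not> ?thesis"
  then have less: "card (nbrs (V s) x) < d s" by simp
  have val: "valid V" using opt by (simp add: size_optimal_def)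
  then have "free s (insert x (V s))" using free_insert[OF s, of "V s" x] less s x
    by (auto simp: valid_def rest_def)
  then have val': "valid (V(s := insert x (V s)))"
    using x by (intro valid_update[OF val s]) auto
  have x': "x \<notin> V s" "x \<in> rest V" using x s by (auto simp: rest_def)
  have "card (insert x (V s)) = Suc (card (V s))" using x' finite_class[OF val s] by simp
  moreover have "card (rest (V(s := insert x (V s)))) < card (rest V)"
  proof (rule psubset_card_mono[OF finite_rest])
    have "rest (V(s := insert x (V s))) \<subseteq> rest V - {x}" using s by (auto simp: rest_def split: if_splits)
    then show "rest (V(s := insert x (V s))) \<subset> rest V" using x' by blast
  qed
  ultimately show False using opt val' unfolding size_optimal_def
    by (metis fun_upd_other fun_upd_same lessI not_less)
qed

lemma degree_split:
  assumes "valid V"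
  shows "card (nbrs VV x) = card (nbrs (rest V) x) + (\<Sum>s\<in>I. card (nbrs (V s) x))"
proof -
  have "nbrs VV x = nbrs (rest V) x \<union> (\<Union>s\<in>I. nbrs (V s) x)"
    using assms by (auto simp: nbrs_def rest_def valid_def)
  moreover have "nbrs (rest V) x \<inter> (\<Union>s\<in>I. nbrs (V s) x) = {}"
    by (auto simp: nbrs_def rest_def)
  moreover have "card (\<Union>s\<in>I. nbrs (V s) x) = (\<Sum>s\<in>I. card (nbrs (V s) x))"
    using assms finite_I finite_class[OF assms] finite_nbrs
    by (intro card_UN_disjoint) (auto simp: valid_def disjoint_family_on_def nbrs_def)
  moreover have "finite (\<Union>s\<in>I. nbrs (V s) x)" using finite_I finite_class[OF assms] finite_nbrs by auto
  ultimately show ?thesis using finite_nbrs[OF finite_rest] by (simp add: card_Un_disjoint)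
qed

lemma rest_degree_le:
  assumes opt: "size_optimal V" and x: "x \<in> rest V"
  shows "card (nbrs (rest V) x) \<le> q"
proof -
  have "(\<Sum>s\<in>I. d s) \<le> (\<Sum>s\<in>I. card (nbrs (V s) x))"
    using class_degree_ge[OF opt _ x] by (rule sum_mono)
  then show ?thesis using degree_split[of V x] degree_bound[of x] x opt
    by (auto simp: size_optimal_def rest_def)
qed

lemma class_degree_eq:
  assumes opt: "size_optimal V" and s: "s \<in> I" and x: "x \<in> rest V" and "card (nbrs (rest V) x) = q"
  shows "card (nbrs (V s) x) = d s"
proof (rule ccontr)
  assume "\<not> ?thesis"
  then have "d s < card (nbrs (V s) x)" using class_degree_ge[OF opt s x] by simp
  then have "(\<Sum>s\<in>I. d s) < (\<Sum>s\<in>I. card (nbrs (V s) x))"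
    using class_degree_ge[OF opt _ x] s finite_I by (intro sum_strict_mono_ex1) auto
  then show False using degree_split[of V x] degree_bound[of x] x opt assms(4)
    by (auto simp: size_optimal_def rest_def)
qed

text \<open>The vertex \<open>v\<close> enters the class \<open>s\<close> and \<open>z\<close> leaves it. It suffices to move along one edge of a path from
\<open>v\<close> to \<open>z\<close>: the vertex \<open>z\<close> that is currently outside has exactly \<open>d s\<close> neighbours in the class, so it may
enter once one of these, \<open>z'\<close>, has left. Minimality of the number of edges then forces \<open>q\<close> neighbours
of \<open>z'\<close> in the rest, and the argument can be repeated. The set \<open>insert v (V s)\<close> is the same all along.\<close>

lemma component_exchange:
  assumes opt: "edge_optimal V" and s: "s \<in> I" and v: "v \<in> rest V" "card (nbrs (rest V) v) = q"
    and z: "conn (insert v (V s)) v z"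
  shows "edge_optimal (exchange V s v z) \<and> rest (exchange V s v z) = insert z (rest V - {v})
    \<and> card (nbrs (rest V - {v}) z) = q"
  using z
proof (induction rule: conn_induct)
  case refl
  have "exchange V s v v = V" using v s by (auto simp: exchange_def rest_def)
  moreover have "insert v (rest V - {v}) = rest V" using v by auto
  moreover have "nbrs (rest V - {v}) v = nbrs (rest V) v" by (auto simp: nbrs_def adj_irrefl)
  ultimately show ?case using opt v by simp
next
  case (step z z')
  let ?X = "insert v (V s)" and ?Y = "rest V - {v}" and ?V1 = "exchange V s v z" and ?V2 = "exchange V s v z'"
  have fY: "finite ?Y" using finite_rest by simp
  have notY: "y \<notin> ?Y" if "y \<in> ?X" for y using that s by (auto simp: rest_def)
  have ne: "z' \<noteq> z" using step.hyps adj_irrefl by auto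
  have opt1: "size_optimal ?V1" and val1: "valid ?V1" using step.IH by (auto simp: edge_optimal_def size_optimal_def)
  have r1: "rest ?V1 = insert z ?Y" using step.IH by simp
  have z1: "z \<in> rest ?V1" "card (nbrs (rest ?V1) z) = q" using step.IH by (simp_all add: nbrs_insert_self)
  have V1s: "?V1 s = ?X - {z}" by (simp add: exchange_def)
  have deg1: "card (nbrs (?V1 s) z) = d s" using class_degree_eq[OF opt1 s z1] .
  have z': "z' \<in> nbrs (?V1 s) z" using step.hyps ne by (auto simp: V1s nbrs_def)
  have f1: "finite (?V1 s)" using finite_class[OF val1 s] .
  have "nbrs (?V1 s - {z'}) z \<subset> nbrs (?V1 s) z" using z' by (auto simp: nbrs_def)
  then have less: "card (nbrs (?V1 s - {z'}) z) < d s"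
    unfolding deg1[symmetric] by (intro psubset_card_mono finite_nbrs f1)
  have V1sub: "?V1 s \<subseteq> VV" "free s (?V1 s)" using val1 s by (auto simp: valid_def)
  have "free s (insert z (?V1 s - {z'}))"
    using V1sub z1(1) less
    by (intro free_insert[OF s] free_subset[OF s V1sub]) (auto simp: rest_def)
  moreover have "insert z (?V1 s - {z'}) = insert z (?V1 s) - {z'}" using ne by auto
  ultimately have free2: "free s (insert z (?V1 s) - {z'})" by simp
  have eq2: "exchange ?V1 s z z' = ?V2"
    using step.hyps ne by (auto simp: exchange_def fun_eq_iff)
  have opt2: "size_optimal ?V2"
    using size_optimal_exchange[OF opt1 s z1(1) _ free2] z' nbrs_subset unfolding eq2 by auto
  have "rest ?V2 = insert z' (rest ?V1 - {z})"
    using valid_exchange(2)[OF val1 s z1(1) _ free2] z' nbrs_subset unfolding eq2 by auto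
  then have r2: "rest ?V2 = insert z' ?Y" using r1 notY[OF step.hyps(2)] by auto
  have "card (nbrs (rest ?V2) z') \<le> q" using rest_degree_le[OF opt2, of z'] r2 by simp
  then have le: "card (nbrs ?Y z') \<le> q" by (simp add: r2 nbrs_insert_self)
  have ds1: "degree_sum (rest ?V1) = degree_sum ?Y + 2 * q"
    using degree_sum_insert[OF fY notY[OF step.hyps(2)]] step.IH by simp
  have ds2: "degree_sum (rest ?V2) = degree_sum ?Y + 2 * card (nbrs ?Y z')"
    using degree_sum_insert[OF fY notY[OF step.hyps(3)]] r2 by simp
  have "degree_sum (rest ?V1) \<le> degree_sum (rest ?V2)"
    using step.IH opt2 unfolding edge_optimal_def by blast
  then have eq: "card (nbrs ?Y z') = q" using ds1 ds2 le by linarith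
  then have "degree_sum (rest ?V2) = degree_sum (rest ?V1)" using ds1 ds2 by simp
  moreover have "edge_optimal ?V1" using step.IH by simp
  ultimately have "edge_optimal ?V2" using opt2 unfolding edge_optimal_def by simp
  then show ?case using r2 eq by blast
qed

text \<open>Every vertex \<open>z\<close> of the component can be placed outside, where having \<open>q\<close> neighbours in the rest leaves
exactly \<open>d s\<close> for the class.\<close>

lemma component_regular:
  assumes opt: "edge_optimal V" and s: "s \<in> I" and v: "v \<in> rest V" "card (nbrs (rest V) v) = q"
    and z: "conn (insert v (V s)) v z"
  shows "card (nbrs (insert v (V s)) z) = d s"
proof -
  let ?V1 = "exchange V s v z"
  have ce: "edge_optimal ?V1" "rest ?V1 = insert z (rest V - {v})" "card (nbrs (rest V - {v}) z) = q"
    using component_exchange[OF assms] by auto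
  then have "card (nbrs (?V1 s) z) = d s"
    using class_degree_eq[of ?V1 s z] s by (auto simp: edge_optimal_def nbrs_insert_self)
  moreover have "nbrs (?V1 s) z = nbrs (insert v (V s)) z"
    using adj_irrefl by (auto simp: exchange_def nbrs_def)
  ultimately show ?thesis by simp
qed

lemma optimalD: "optimal V \<Longrightarrow> edge_optimal V" "optimal V \<Longrightarrow> size_optimal V" "optimal V \<Longrightarrow> valid V"
  by (auto simp: optimal_def edge_optimal_def size_optimal_def)

lemma tightD: "tight q W v \<Longrightarrow> v \<in> W" "tight q W v \<Longrightarrow> card (nbrs W v) = q"
  "tight q W v \<Longrightarrow> almost_clique (nbrs W v)"
  by (auto simp: tight_def)

lemma nbrs_remove_self: "nbrs (W - {x}) x = nbrs W x"
  by (auto simp: nbrs_def adj_irrefl)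

lemma nbr_degree_less:
  assumes "finite Y" "x \<notin> Y" "\<And>y. y \<in> insert x Y \<Longrightarrow> card (nbrs (insert x Y) y) \<le> q" "y \<in> nbrs Y x"
  shows "card (nbrs Y y) < q"
proof -
  have "adj y x" using assms(4) adj_commute[of y x] by (simp add: nbrs_def)
  then have "nbrs (insert x Y) y = insert x (nbrs Y y)" by (simp add: nbrs_insert)
  moreover have "x \<notin> nbrs Y y" using assms(2) by (auto simp: nbrs_def)
  ultimately show ?thesis using assms(3)[of y] assms(1,4) finite_nbrs[OF assms(1)] by (auto simp: nbrs_def)
qed

text \<open>Taking out \<open>v\<close> lowers the clique score by \<open>q\<close>, and bringing in \<open>z\<close> raises it by at most \<open>q\<close>, with equality
only if \<open>z\<close> is tight.\<close>

lemma tight_exchange: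
  assumes opt: "optimal V" and s: "s \<in> I" and v: "tight q (rest V) v"
    and z: "conn (insert v (V s)) v z"
  shows "optimal (exchange V s v z)" "rest (exchange V s v z) = insert z (rest V - {v})"
    "tight q (insert z (rest V - {v})) z"
proof -
  let ?Y = "rest V - {v}" and ?V1 = "exchange V s v z"
  note vv = tightD[OF v]
  have ce: "edge_optimal ?V1" "rest ?V1 = insert z ?Y" "card (nbrs ?Y z) = q"
    using component_exchange[OF optimalD(1)[OF opt] s vv(1,2) z] by auto
  have fY: "finite ?Y" using finite_rest by simp
  have vY: "v \<notin> ?Y" "insert v ?Y = rest V" using vv by auto
  have "z \<in> insert v (V s)" using conn_in[OF z] by simp
  then have zY: "z \<notin> ?Y" using s by (auto simp: rest_def)
  have degv: "card (nbrs ?Y y) < q" if "y \<in> nbrs ?Y v" for y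
    using nbr_degree_less[OF fY vY(1) _ that] rest_degree_le[OF optimalD(2)[OF opt]]
    unfolding vY(2) by blast
  have degz: "card (nbrs ?Y y) < q" if "y \<in> nbrs ?Y z" for y
    using nbr_degree_less[OF fY zY _ that] rest_degree_le[of ?V1] ce by (simp add: edge_optimal_def)
  have q0: "q > 0" using q4 by simp
  have "clique_gain q ?Y v = q"
    by (rule clique_gain_tight[OF fY vY(1) q4 _ degv]) (use vv in \<open>simp_all add: nbrs_remove_self\<close>)
  then have sv: "clique_score q (rest V) = clique_score q ?Y + q"
    using clique_score_insert[OF fY vY(1) q0] vY(2) by simp
  have sz: "clique_score q (rest ?V1) = clique_score q ?Y + clique_gain q ?Y z"
    using clique_score_insert[OF fY zY q0] ce(2) by simp
  have ge: "clique_score q (rest V) \<le> clique_score q (rest ?V1)"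
    using opt ce(1) by (auto simp: optimal_def)
  have ac: "almost_clique (nbrs ?Y z)"
    using clique_gain_not_tight[OF fY zY q4 ce(3) degz] sv sz ge by fastforce
  then show "tight q (insert z ?Y) z" using ce(3) by (simp add: tight_def nbrs_insert_self)
  have "clique_gain q ?Y z = q" using clique_gain_tight[OF fY zY q4 ce(3) degz ac] .
  then have "clique_score q (rest ?V1) = clique_score q (rest V)" using sv sz by simp
  then show "optimal ?V1" using opt ce(1) by (simp add: optimal_def)
  show "rest ?V1 = insert z ?Y" using ce(2) .
qed

end

section \<open>Attached vertices\<close>

context free_partitions begin

definition closed_nbrs :: "'a set \<Rightarrow> 'a \<Rightarrow> 'a set" where
  "closed_nbrs W v = insert v (nbrs W v)"

text \<open>The attached vertices of class \<open>s\<close> could replace any tight vertex of the closed neighbourhood of \<open>v\<close>;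
they depend on this closed neighbourhood only.\<close>

definition attached :: "('i \<Rightarrow> 'a set) \<Rightarrow> 'i \<Rightarrow> 'a \<Rightarrow> 'a set" where
  "attached V s v = {u \<in> V s. nbrs (rest V) u = closed_nbrs (rest V) v}"

lemma tight_exchange_nbrs:
  assumes "optimal V" "s \<in> I" "tight q (rest V) v" "conn (insert v (V s)) v z"
  shows "card (nbrs (rest V - {v}) z) = q" "almost_clique (nbrs (rest V - {v}) z)"
  using tightD(2,3)[OF tight_exchange(3)[OF assms]] by (simp_all add: nbrs_insert_self)

lemma exchange_nbr_degree:
  assumes "optimal V" "s \<in> I" "tight q (rest V) v" "conn (insert v (V s)) v z"
    and "y \<in> nbrs (rest V - {v}) z"
  shows "card (nbrs (rest V - {v}) y) < q"
proof (rule nbr_degree_less[OF _ _ _ assms(5)])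
  note te = tight_exchange[OF assms(1-4)]
  show "finite (rest V - {v})" using finite_rest by simp
  show "z \<notin> rest V - {v}" using conn_in[OF assms(4)] rest_not_in[OF _ assms(2)] by auto
  show "card (nbrs (insert z (rest V - {v})) y') \<le> q" if "y' \<in> insert z (rest V - {v})" for y'
    using rest_degree_le[OF optimalD(2)[OF te(1)]] that unfolding te(2) by blast
qed

lemma tight_universal:
  assumes opt: "optimal V" and v: "tight q (rest V) v"
    and w: "universal (nbrs (rest V) v) w"
  shows "tight q (rest V) w" "closed_nbrs (rest V) w = closed_nbrs (rest V) v"
  using tight_universal_nbr[OF finite_rest rest_degree_le[OF optimalD(2)[OF opt]] v w]
  by (simp_all add: closed_nbrs_def)

text \<open>After the exchange, the neighbourhood \<open>T'\<close> of \<open>z\<close> is an almost clique like the neighbourhood \<open>T\<close> of \<open>v\<close>, so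
the two are equal or disjoint. If they are equal, \<open>z\<close> must be adjacent to \<open>v\<close>: otherwise a universal
vertex \<open>w\<close> of \<open>T\<close>, which is tight as well, could be exchanged with its neighbour \<open>z\<close>, and \<open>z\<close> would be
left with the \<open>q - 1\<close> neighbours \<open>T - {w}\<close>.\<close>

lemma attached_or_apart:
  assumes opt: "optimal V" and s: "s \<in> I" and v: "tight q (rest V) v"
    and z: "conn (insert v (V s)) v z" "z \<noteq> v"
  shows "nbrs (rest V) z = closed_nbrs (rest V) v \<or>
    nbrs (rest V) z \<inter> closed_nbrs (rest V) v \<subseteq> {v}"
proof -
  let ?W = "rest V" and ?Y = "rest V - {v}"
  let ?T = "nbrs ?W v" and ?T' = "nbrs ?Y z"
  note vv = tightD[OF v]
  note T' = tight_exchange_nbrs[OF opt s v z(1)]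
  have vT: "v \<notin> ?T" by (simp add: nbrs_def adj_irrefl)
  have "?T = ?T' \<or> ?T \<inter> ?T' = {}"
    using exchange_nbr_degree[OF opt s v z(1)] finite_rest[of V] vT vv(2,3) T' q4 nbrs_subset
    by (intro almost_cliques_equal_or_disjoint[of ?Y]) auto
  then show ?thesis
  proof
    assume dis: "?T \<inter> ?T' = {}"
    have "nbrs ?W z \<inter> closed_nbrs ?W v \<subseteq> {v}"
    proof
      fix t assume t: "t \<in> nbrs ?W z \<inter> closed_nbrs ?W v"
      show "t \<in> {v}"
      proof (rule ccontr)
        assume "t \<notin> {v}"
        then have "t \<in> ?T" "t \<in> ?T'" using t by (auto simp: closed_nbrs_def nbrs_def)
        then show False using dis by blast
      qed
    qed
    then show ?thesis ..
  next
    assume eq: "?T = ?T'"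
    have "adj z v"
    proof (rule ccontr)
      assume nadj: "\<not> adj z v"
      then have nz: "nbrs ?W z = ?T" unfolding eq by (auto simp: nbrs_def)
      obtain w where w: "universal ?T w"
        using almost_clique_two_universal[OF vv(3)] vv(2) q4 by metis
      note tw = tight_universal(1)[OF opt v w]
      have zV: "z \<in> V s" using conn_in[OF z(1)] z(2) by simp
      have "adj w z" using universal_in[OF w] unfolding eq by (simp add: nbrs_def adj_commute[of w z])
      then have "conn (insert w (V s)) w z" using zV by (intro conn_edge) auto
      then have "card (nbrs (?W - {w}) z) = q" using tight_exchange_nbrs(1)[OF opt s tw] by simp
      moreover have "nbrs (?W - {w}) z = ?T - {w}" unfolding nz[symmetric] by (auto simp: nbrs_def)
      ultimately show False using universal_in[OF w] vv(2) finite_nbrs[OF finite_rest] q4 by simp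
    qed
    then have "nbrs ?W z = insert v ?T'" using vv(1) by (auto simp: nbrs_def)
    then show ?thesis using eq by (simp add: closed_nbrs_def)
  qed
qed

text \<open>One neighbour in the closed neighbourhood of \<open>v\<close>, other than \<open>v\<close>, excludes the second case.\<close>

lemma attachedI:
  assumes opt: "optimal V" and s: "s \<in> I" and v: "tight q (rest V) v"
    and u: "conn (insert v (V s)) v u" "u \<noteq> v"
    and y: "y \<in> closed_nbrs (rest V) v" "y \<noteq> v" "adj u y"
  shows "u \<in> attached V s v"
proof -
  have "y \<in> rest V" using y(1,2) by (auto simp: closed_nbrs_def nbrs_def)
  then have "y \<in> nbrs (rest V) u" using y(3) by (simp add: nbrs_def)
  then have "nbrs (rest V) u = closed_nbrs (rest V) v"
    using attached_or_apart[OF opt s v u] y(1,2) by blast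
  then show ?thesis using conn_in[OF u(1)] u(2) by (auto simp: attached_def)
qed

text \<open>Exchange \<open>v\<close> with \<open>u\<close>, and then a universal vertex \<open>w\<close> with \<open>u'\<close>. Then \<open>u'\<close> must have \<open>q\<close> neighbours in
the rest, but only \<open>q - 1\<close> of its old neighbours are still there; the missing one is \<open>u\<close>.\<close>

lemma attached_adjacent:
  assumes opt: "optimal V" and v: "tight q (rest V) v" and s: "s \<in> I" "s' \<in> I"
    and u: "u \<in> attached V s v" "u' \<in> attached V s' v" "u \<noteq> u'"
  shows "adj u u'"
proof (rule ccontr)
  assume nadj: "\<not> adj u u'"
  let ?W = "rest V" and ?Y = "rest V - {v}"
  let ?T = "nbrs ?W v" and ?V1 = "exchange V s v u"
  note vv = tightD[OF v]
  have nu: "nbrs ?W u = insert v ?T" "nbrs ?W u' = insert v ?T" "u \<in> V s" "u' \<in> V s'"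
    using u by (auto simp: attached_def closed_nbrs_def)
  have vT: "v \<notin> ?T" by (simp add: nbrs_def adj_irrefl)
  have "adj u v" using nu(1) by (auto simp: nbrs_def)
  then have cu: "conn (insert v (V s)) v u" using nu(3) adj_commute[of u v] by (intro conn_edge) auto
  note te = tight_exchange[OF opt s(1) v cu]
  have W1: "rest ?V1 = insert u ?Y" by (rule te(2))
  have "nbrs (rest ?V1) u = nbrs ?W u - {v}" unfolding W1 nbrs_insert_self by (auto simp: nbrs_def)
  then have n1: "nbrs (rest ?V1) u = ?T" using nu(1) vT by simp
  obtain w where w: "universal ?T w"
    using almost_clique_two_universal[OF vv(3)] vv(2) q4 by metis
  have tw: "tight q (rest ?V1) w"
    using tight_universal(1)[OF te(1) te(3)[folded W1]] w unfolding n1 by blast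
  have "u' \<in> ?V1 s'" using nu(4) u(3) by (auto simp: exchange_def)
  moreover have "adj w u'"
  proof -
    have "w \<in> nbrs ?W u'" using universal_in[OF w] nu(2) by simp
    then show ?thesis by (simp add: nbrs_def adj_commute[of w u'])
  qed
  ultimately have "conn (insert w (?V1 s')) w u'" by (intro conn_edge) auto
  then have "card (nbrs (rest ?V1 - {w}) u') = q" using tight_exchange_nbrs(1)[OF te(1) s(2) tw] by simp
  moreover have "nbrs (rest ?V1 - {w}) u' = nbrs ?W u' - {v} - {w}"
    using nadj unfolding W1 by (auto simp: nbrs_def adj_commute[of u u'])
  ultimately have "card (?T - {w}) = q" using nu(2) vT by simp
  then show False using universal_in[OF w] vv(2) finite_nbrs[OF finite_rest] q4 by simp
qed

lemma closed_nbrs_almost_clique: "tight q W v \<Longrightarrow> almost_clique (closed_nbrs W v)"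
  unfolding closed_nbrs_def tight_def
  by (intro almost_clique_insert_universal) (auto simp: nbrs_def)

lemma attached_subset_nbrs:
  assumes "tight q (rest V) v"
  shows "attached V s v \<subseteq> nbrs (V s) v"
proof
  fix u assume "u \<in> attached V s v"
  then have "u \<in> V s" "v \<in> nbrs (rest V) u" by (auto simp: attached_def closed_nbrs_def)
  then show "u \<in> nbrs (V s) v" by (simp add: nbrs_def adj_commute[of v u])
qed

text \<open>Otherwise the closed neighbourhood of \<open>v\<close> and the \<open>d s\<close> attached vertices of each class \<open>s\<close> form a set of
\<open>q + (\<Sum>s\<in>I. d s) + 1\<close> vertices whose only missing edge can be the one of the closed neighbourhood.\<close>

lemma ex_colour_not_all_attached:
  assumes opt: "optimal V" and v: "tight q (rest V) v"
  shows "\<exists>s\<in>I. card (attached V s v) < d s"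
proof (rule ccontr)
  assume "\<not> ?thesis"
  then have ge: "d s \<le> card (attached V s v)" if "s \<in> I" for s using that by force
  note vv = tightD[OF v]
  let ?D = "closed_nbrs (rest V) v"
  let ?A = "\<Union>s\<in>I. attached V s v"
  have fin: "finite (attached V s v)" if "s \<in> I" for s
    using finite_class[OF optimalD(3)[OF opt] that] by (simp add: attached_def)
  have eq: "card (attached V s v) = d s" if s: "s \<in> I" for s
    using ge[OF s] class_degree_eq[OF optimalD(2)[OF opt] s vv(1,2)]
      card_mono[OF finite_nbrs[OF finite_class[OF optimalD(3)[OF opt] s]] attached_subset_nbrs[OF v]]
    by fastforce
  have "card ?A = (\<Sum>s\<in>I. card (attached V s v))"
    using finite_I fin optimalD(3)[OF opt]
    by (intro card_UN_disjoint) (auto simp: attached_def valid_def disjoint_family_on_def)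
  then have cA: "card ?A = (\<Sum>s\<in>I. d s)" using eq by simp
  have cD: "card ?D = q + 1" "finite ?D" "?D \<subseteq> rest V"
    using vv finite_nbrs[OF finite_rest] not_in_own_nbrs[of v "rest V"] nbrs_subset
    by (auto simp: closed_nbrs_def)
  have "?D \<inter> ?A = {}" using cD(3) by (auto simp: attached_def rest_def)
  then have "card (?D \<union> ?A) = q + (\<Sum>s\<in>I. d s) + 1"
    using cA cD finite_I fin by (subst card_Un_disjoint) auto
  moreover have "?D \<union> ?A \<subseteq> VV"
    using cD(3) optimalD(3)[OF opt] by (auto simp: attached_def rest_def valid_def)
  moreover have "almost_clique (?D \<union> ?A)"
  proof -
    have AD: "adj x y" if "x \<in> ?A" "y \<in> ?D" for x y
    proof -
      have "y \<in> nbrs (rest V) x" using that by (auto simp: attached_def)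
      then show ?thesis by (simp add: nbrs_def)
    qed
    have AA: "adj x y" if xy: "x \<in> ?A" "y \<in> ?A" "x \<noteq> y" for x y
      using attached_adjacent[OF opt v _ _ _ _ xy(3)] xy by blast
    have in_D: "x \<in> ?D \<and> y \<in> ?D"
      if "x \<in> ?D \<union> ?A" "y \<in> ?D \<union> ?A" "x \<noteq> y" "\<not> adj x y" for x y
      using that AD AA adj_commute[of x y] by blast
    show ?thesis
    proof (rule almost_cliqueI)
      fix x y x' y'
      assume h: "x \<in> ?D \<union> ?A" "y \<in> ?D \<union> ?A" "x \<noteq> y" "\<not> adj x y"
        "x' \<in> ?D \<union> ?A" "y' \<in> ?D \<union> ?A" "x' \<noteq> y'" "\<not> adj x' y'"
      show "{x, y} = {x', y'}"
        using almost_clique_nonedge_unique[OF closed_nbrs_almost_clique[OF v], of x y x' y']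
          in_D[OF h(1-4)] in_D[OF h(5-8)] h by blast
    qed
  qed
  ultimately show False using no_almost_clique by blast
qed

text \<open>Among the vertices of the component of \<open>v\<close> that are not attached, one that leaves as many vertices as
possible connected to \<open>v\<close> is not a cut vertex: a vertex \<open>y\<close> that it separates from \<open>v\<close> is not adjacent to
\<open>v\<close>, hence not attached, and would be a better choice.\<close>

lemma ex_apart_noncut:
  assumes opt: "optimal V" and s: "s \<in> I" and v: "tight q (rest V) v"
    and less: "card (attached V s v) < d s"
  obtains z where "conn (insert v (V s)) v z" "z \<noteq> v" "z \<notin> attached V s v"
    "\<And>y. conn (insert v (V s)) v y \<Longrightarrow> y \<noteq> z \<Longrightarrow> conn (insert v (V s) - {z}) v y"
proof -
  let ?X = "insert v (V s)"
  note vv = tightD[OF v]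
  let ?cand = "\<lambda>z. conn ?X v z \<and> z \<noteq> v \<and> z \<notin> attached V s v"
  let ?C = "\<lambda>z. {y. conn (?X - {z}) v y}"
  have fX: "finite ?X" using finite_class[OF optimalD(3)[OF opt] s] by simp
  have C_sub: "?C z \<subseteq> ?X" if "z \<noteq> v" for z using conn_in[of "?X - {z}" v] that by auto
  have "card (attached V s v) < card (nbrs (V s) v)"
    using less class_degree_eq[OF optimalD(2)[OF opt] s vv(1,2)] by simp
  moreover have "finite (attached V s v)"
    using fX by (simp add: attached_def)
  ultimately have "\<not> nbrs (V s) v \<subseteq> attached V s v" using card_mono not_le by blast
  then obtain u where u: "u \<in> nbrs (V s) v" "u \<notin> attached V s v" by blast
  have "?cand u" using u v rest_not_in[OF vv(1) s] by (auto simp: nbrs_def intro!: conn_edge)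
  moreover have "card (?C z) < Suc (card ?X)" if "?cand z" for z
    using card_mono[OF fX C_sub[of z]] that by simp
  ultimately obtain z where z: "?cand z" and max: "\<And>z'. ?cand z' \<Longrightarrow> card (?C z') \<le> card (?C z)"
    using ex_has_greatest_nat[of ?cand u "\<lambda>z. card (?C z)" "Suc (card ?X)"] by blast
  have "conn (?X - {z}) v y" if y: "conn ?X v y" "y \<noteq> z" for y
  proof (rule ccontr)
    assume out: "\<not> conn (?X - {z}) v y"
    then have yv: "y \<noteq> v" using conn_refl by auto
    have yX: "y \<in> ?X" using conn_in[OF y(1)] by simp
    have "y \<notin> attached V s v"
    proof
      assume "y \<in> attached V s v"
      then have "adj v y" using attached_subset_nbrs[OF v] by (auto simp: nbrs_def)
      then have "conn (?X - {z}) v y" using yX y(2) z by (intro conn_edge) auto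
      then show False using out by simp
    qed
    then have "?cand y" using y yv by simp
    moreover have "?C z \<subseteq> ?C y" using conn_avoid[OF out] by blast
    moreover have "z \<in> ?C y" using conn_avoid_swap[OF out] z y(2) by auto
    moreover have "z \<notin> ?C z" using conn_in[of "?X - {z}" v z] z by auto
    ultimately have "card (?C z) < card (?C y)"
      using finite_subset[OF C_sub[OF yv] fX] by (intro psubset_card_mono) auto
    then show False using max[of y] \<open>?cand y\<close> by simp
  qed
  then show ?thesis using that z by blast
qed

end

section \<open>The chain of exchanges\<close>

context free_partitions begin

text \<open>A state of the chain of exchanges in class \<open>s\<close>. The family \<open>\<T>\<close> holds the remnants of the tight
neighbourhoods that were left behind, and \<open>Q\<close> the vertices of the components in class \<open>s\<close> that were
passed through; \<open>Q\<close> is a union of components of the class. The last two conditions prevent a return.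
A vertex outside \<open>Q\<close> is not adjacent to all of a remnant, so it cannot move into the place of the vertex
that left it. Each component of \<open>Q\<close> has a vertex \<open>x\<close> that is adjacent to some but not to all vertices of a
remnant, or of the present tight neighbourhood; so \<open>x\<close> cannot become tight by an exchange, and no later
tight vertex is adjacent to that component.\<close>

definition chain_state :: "'i \<Rightarrow> ('i \<Rightarrow> 'a set) \<Rightarrow> 'a \<Rightarrow> 'a set set \<Rightarrow> 'a set \<Rightarrow> bool" where
  "chain_state s V v \<T> Q \<longleftrightarrow>
     optimal V \<and> tight q (rest V) v \<and> card (attached V s v) < d s \<and>
     Q \<subseteq> V s \<and> (\<forall>x\<in>Q. \<forall>y\<in>V s. adj x y \<longrightarrow> y \<in> Q) \<and> nbrs Q v = {} \<and>
     (\<forall>T\<in>\<T>. T \<subseteq> rest V - closed_nbrs (rest V) v \<and> card T = q \<and> almost_clique T) \<and>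
     (\<forall>T\<in>\<T>. \<forall>u\<in>V s - Q. \<exists>t\<in>T. \<not> adj u t) \<and>
     (\<forall>y\<in>Q. \<exists>x T z. conn (V s) y x \<and> T \<in> insert (nbrs (rest V) v) \<T> \<and> z \<in> T \<and> adj x z \<and>
        (\<exists>t\<in>T. \<not> adj x t))"

text \<open>Exchange \<open>v\<close> with a vertex \<open>z\<close> of its component that is neither attached nor a cut vertex. The
neighbourhood \<open>T\<close> of \<open>v\<close> becomes a new remnant, and \<open>z\<close> is tight with a neighbourhood \<open>T'\<close> disjoint from all
remnants. The next tight vertex is a universal vertex \<open>w\<close> of \<open>T'\<close>. It has no neighbour in the component
\<open>R\<close> that was left: \<open>R\<close> would belong to the component of \<open>w\<close>, and the \<open>d s\<close> neighbours of \<open>z\<close> in \<open>R\<close>, being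
adjacent to \<open>z\<close>, would all be attached, contrary to the choice of the colour. That this choice remains
valid is seen by a similar argument: if all neighbours of \<open>z\<close> in the class were attached, they would form
with \<open>z\<close> a clique on \<open>d s + 1\<close> vertices, hence the whole component of \<open>v\<close>, but \<open>v\<close> has no neighbour
in \<open>T'\<close>.\<close>

lemma chain_step:
  assumes s: "s \<in> I" and st: "chain_state s V v \<T> Q"
  shows "nbrs (rest V) v \<notin> \<T> \<and> (\<exists>V' v' Q'. chain_state s V' v' (insert (nbrs (rest V) v) \<T>) Q')"
proof -
  note conds = st[unfolded chain_state_def]
  from conds have opt: "optimal V" by (elim conjE)
  from conds have v: "tight q (rest V) v" by (elim conjE)
  from conds have less: "card (attached V s v) < d s" by (elim conjE)
  from conds have QV: "Q \<subseteq> V s" by (elim conjE)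
  from conds have Qv: "nbrs Q v = {}" by (elim conjE)
  from conds have Qcl': "\<forall>x\<in>Q. \<forall>y\<in>V s. adj x y \<longrightarrow> y \<in> Q" by (elim conjE)
  from conds have TT': "\<forall>T\<in>\<T>. T \<subseteq> rest V - closed_nbrs (rest V) v \<and> card T = q \<and> almost_clique T" by (elim conjE)
  from conds have full': "\<forall>T\<in>\<T>. \<forall>u\<in>V s - Q. \<exists>t\<in>T. \<not> adj u t" by (elim conjE)
  from conds have anchor': "\<forall>y\<in>Q. \<exists>x T z. conn (V s) y x \<and> T \<in> insert (nbrs (rest V) v) \<T> \<and> z \<in> T \<and>
        adj x z \<and> (\<exists>t\<in>T. \<not> adj x t)" by (elim conjE)
  have Qcl: "y \<in> Q" if "x \<in> Q" "y \<in> V s" "adj x y" for x y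
    using Qcl'[rule_format, OF that] .
  have TT: "U \<subseteq> rest V - closed_nbrs (rest V) v \<and> card U = q \<and> almost_clique U" if "U \<in> \<T>" for U
    using bspec[OF TT' that] .
  have full: "\<exists>t\<in>U. \<not> adj u t" if "U \<in> \<T>" "u \<in> V s" "u \<notin> Q" for U u
    using bspec[OF bspec[OF full' that(1)]] that(2,3) by simp
  have anchor: "\<exists>x U z. conn (V s) y x \<and> U \<in> insert (nbrs (rest V) v) \<T> \<and> z \<in> U \<and> adj x z \<and>
      (\<exists>t\<in>U. \<not> adj x t)" if "y \<in> Q" for y
    using bspec[OF anchor' that] .
  define W where "W = rest V"
  define X where "X = insert v (V s)"
  define T where "T = nbrs W v"
  define Y where "Y = W - {v}"
  note vv = tightD[OF v, folded W_def]
  have vV: "v \<notin> V s" using rest_not_in[OF vv(1)[unfolded W_def] s] .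
  have WV: "W \<inter> V s = {}" using s by (auto simp: W_def rest_def)
  have fW: "finite W" by (simp add: W_def finite_rest)
  have vT: "v \<notin> T" by (simp add: T_def nbrs_def adj_irrefl)
  have TW: "T \<subseteq> Y" using vT by (auto simp: T_def Y_def nbrs_def)
  have cT: "card T = q" "almost_clique T" using vv by (simp_all add: T_def)
  have D: "closed_nbrs W v = insert v T" by (simp add: closed_nbrs_def T_def)
  have Tne: "T \<noteq> {}" using cT q4 by auto
  have T_new: "T \<notin> \<T>"
  proof
    assume "T \<in> \<T>"
    then have "T \<inter> closed_nbrs W v = {}" using TT by (auto simp: W_def)
    then show False using Tne by (auto simp: D)
  qed
  have Q_off: "y \<notin> Q" if "conn X v y" for y
    using that
  proof (induction rule: conn_induct)
    case refl
    then show ?case using QV vV by auto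
  next
    case (step a b)
    show ?case
    proof
      assume b: "b \<in> Q"
      have ba: "adj b a" using step.hyps(4) adj_commute by blast
      show False
      proof (cases "a = v")
        case True
        then have "b \<in> nbrs Q v" using b step.hyps(4) by (simp add: nbrs_def)
        then show False using Qv by simp
      next
        case False
        then have "a \<in> V s" using step.hyps(2) by (simp add: X_def)
        then show False using Qcl[OF b _ ba] step.IH by blast
      qed
    qed
  qed
  obtain z where z: "conn X v z" "z \<noteq> v" "z \<notin> attached V s v"
    and noncut: "\<And>y. conn X v y \<Longrightarrow> y \<noteq> z \<Longrightarrow> conn (X - {z}) v y"
    using ex_apart_noncut[OF opt s v less] unfolding X_def by metis
  define V' where "V' = exchange V s v z"
  define W' where "W' = rest V'"
  define T' where "T' = nbrs Y z"
  have zX: "z \<in> X" "z \<in> V s" "z \<notin> Q" using conn_in[OF z(1)] z(2) Q_off[OF z(1)] by (auto simp: X_def)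
  have zW: "z \<notin> W" using zX(2) WV by blast
  note te = tight_exchange[OF opt s v z(1)[unfolded X_def], folded V'_def, folded W_def, folded Y_def]
  have opt': "optimal V'" by (rule te(1))
  have W': "W' = insert z Y" using te(2) by (simp add: W'_def)
  have tz: "tight q (rest V') z" using te(2,3) by simp
  have V's: "V' s = X - {z}" by (simp add: V'_def exchange_def X_def)
  have nz: "nbrs W' z = T'" by (simp add: W' T'_def nbrs_insert_self)
  have T': "T' \<subseteq> Y" "card T' = q" "almost_clique T'"
    using tightD(2,3)[OF tz] nbrs_subset nz by (auto simp: W'_def T'_def)
  have D': "closed_nbrs W' z = insert z T'" by (simp add: closed_nbrs_def nz)
  have zT': "z \<notin> T'" by (simp add: T'_def nbrs_def adj_irrefl)
  \<comment> \<open>As \<open>z\<close> is not attached, its new neighbourhood lies apart from the one left behind.\<close>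
  have apart: "T' \<inter> insert v T = {}"
  proof -
    have "nbrs W z \<inter> insert v T \<subseteq> {v}"
      using attached_or_apart[OF opt s v z(1)[unfolded X_def] z(2)] z(3) zX(2)
      by (auto simp: attached_def W_def[symmetric] D)
    moreover have "T' = nbrs W z - {v}" by (auto simp: T'_def Y_def nbrs_def)
    ultimately show ?thesis by blast
  qed
  have UY: "U \<subseteq> Y" "card U = q" "almost_clique U" "z \<notin> U" "T' \<inter> U = {}" if U: "U \<in> insert T \<T>" for U
  proof -
    have UY: "U \<subseteq> Y \<and> card U = q \<and> almost_clique U"
      using U TT[of U] TW cT by (auto simp: Y_def W_def closed_nbrs_def)
    then show "U \<subseteq> Y" "card U = q" "almost_clique U" "z \<notin> U" using zW by (auto simp: Y_def)
    show "T' \<inter> U = {}"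
    proof (cases "U = T")
      case True
      then show ?thesis using apart by auto
    next
      case False
      then have U': "U \<in> \<T>" using U by simp
      have "T' = U \<or> T' \<inter> U = {}"
        using exchange_nbr_degree[OF opt s v z(1)[unfolded X_def], folded W_def, folded Y_def] T' UY q4 fW
        by (intro almost_cliques_equal_or_disjoint[of Y]) (auto simp: T'_def Y_def)
      moreover have "T' \<noteq> U" using full[OF U' zX(2,3)] by (auto simp: T'_def nbrs_def)
      ultimately show ?thesis by blast
    qed
  qed
  have "card T' \<ge> 4" using T'(2) q4 by simp
  then obtain w w2 where univ: "universal T' w" "universal T' w2" and ww2: "w \<noteq> w2"
    using almost_clique_two_universal[OF T'(3)] by blast
  note w = universal_in[OF univ(1)] and w2 = universal_in[OF univ(2)]
  have tw: "tight q (rest V') w" "closed_nbrs W' w = insert z T'"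
    using tight_universal[OF opt' tz, of w] univ(1) nz D' by (auto simp: W'_def)
  have tw2: "tight q (rest V') w2" "closed_nbrs W' w2 = insert z T'"
    using tight_universal[OF opt' tz, of w2] univ(2) nz D' by (auto simp: W'_def)
  have nw: "nbrs W' w = insert z T' - {w}"
    using tw(2) not_in_own_nbrs[of w W'] by (auto simp: closed_nbrs_def)
  have wX: "w \<notin> X" using w T'(1) WV by (auto simp: X_def Y_def)
  have att_eq: "attached V' s w = attached V' s z" "attached V' s w2 = attached V' s z"
    using tw(2) tw2(2) D' by (simp_all add: attached_def W'_def)
  have att_nbrs: "attached V' s z \<subseteq> nbrs X z"
    using attached_subset_nbrs[OF tz, of s] by (auto simp: V's nbrs_def)
  have fX: "finite X" using finite_class[OF optimalD(3)[OF opt] s] by (simp add: X_def)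
  have reg: "card (nbrs X y) = d s" if "conn X v y" for y
    using component_regular[OF optimalD(1)[OF opt] s vv(1,2)[unfolded W_def]] that by (simp add: X_def)
  have nbr_conn: "conn X v y" if "conn X v x" "y \<in> nbrs X x" for x y
  proof -
    have "x \<in> X" using conn_in[OF that(1)] by (simp add: X_def)
    then show ?thesis using that conn_step by (auto simp: nbrs_def)
  qed
  have v_not_att: "v \<notin> attached V' s z"
  proof
    assume "v \<in> attached V' s z"
    then have "nbrs W' v = insert z T'" using D' by (simp add: attached_def W'_def)
    then have "T' \<subseteq> nbrs W' v" by blast
    then have "T' \<subseteq> T" using zT' by (auto simp: W' Y_def T_def nbrs_def)
    then have "T' = {}" using apart by blast
    then show False using T'(2) q4 by simp
  qed
  have less': "card (attached V' s z) < d s"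
  proof (rule ccontr)
    assume "\<not> ?thesis"
    then have A: "attached V' s z = nbrs X z"
      using reg[OF z(1)] att_nbrs finite_nbrs[OF fX] by (intro card_seteq) auto
    have closed: "b \<in> insert z (nbrs X z)"
      if a: "a \<in> insert z (nbrs X z)" and b: "b \<in> X" "adj a b" for a b
    proof (cases "a = z")
      case False
      then have an: "a \<in> nbrs X z" using a by simp
      have sub: "insert z (nbrs X z) - {a} \<subseteq> nbrs X a"
      proof
        fix y assume y: "y \<in> insert z (nbrs X z) - {a}"
        show "y \<in> nbrs X a"
        proof (cases "y = z")
          case True
          then show ?thesis using an zX(1) by (simp add: nbrs_def adj_commute[of a z])
        next
          case False
          then have "y \<in> attached V' s z" "a \<in> attached V' s z" "a \<noteq> y" using y an A by auto
          then have "adj a y" using attached_adjacent[OF opt' tz s s] by blast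
          then show ?thesis using y False by (auto simp: nbrs_def)
        qed
      qed
      have zn: "z \<notin> nbrs X z" by (rule not_in_own_nbrs)
      have "card (insert z (nbrs X z) - {a}) = d s"
        using reg[OF z(1)] an zn finite_nbrs[OF fX] by simp
      then have "insert z (nbrs X z) - {a} = nbrs X a"
        using sub reg[OF nbr_conn[OF z(1) an]] finite_nbrs[OF fX] by (intro card_subset_eq) auto
      moreover have "b \<in> nbrs X a" using b by (simp add: nbrs_def)
      ultimately show ?thesis by blast
    qed (use b in \<open>simp add: nbrs_def\<close>)
    have "v \<in> insert z (nbrs X z)"
      using conn_closed[OF conn_sym[OF z(1)], of "insert z (nbrs X z)"] closed by blast
    then show False using z(2) A v_not_att by auto
  qed
  define R where "R = {y. conn X v y} - {z}"
  define Q' where "Q' = Q \<union> R"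
  have RV': "R \<subseteq> V' s" using conn_in[of X v] by (auto simp: R_def V's X_def)
  have Q'V': "Q' \<subseteq> V' s" using RV' QV zX(3) by (auto simp: Q'_def V's X_def)
  have Q'cl: "y \<in> Q'" if x: "x \<in> Q'" and y: "y \<in> V' s" "adj x y" for x y
  proof (cases "x \<in> Q")
    case True
    have "y \<noteq> v"
    proof
      assume "y = v"
      then have "x \<in> nbrs Q v" using True y(2) by (simp add: nbrs_def adj_commute[of v x])
      then show False using Qv by simp
    qed
    then show ?thesis using Qcl[OF True _ y(2)] y(1) by (auto simp: Q'_def V's X_def)
  next
    case False
    then have "x \<in> R" using x by (simp add: Q'_def)
    then have "conn X v y" using nbr_conn[of x y] y by (auto simp: R_def V's nbrs_def)
    then show ?thesis using y(1) by (auto simp: Q'_def R_def V's)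
  qed
  have R_conn: "conn (V' s) y x" if "y \<in> R" "x \<in> R" for x y
    using that noncut conn_sym conn_trans unfolding R_def V's by blast
  have nbr_z: "x \<in> R" if "x \<in> nbrs X z" for x
    using nbr_conn[OF z(1) that] that not_in_own_nbrs[of z X] by (auto simp: R_def)
  have to_comp: "conn (insert w (V' s)) w x" if y: "y \<in> V' s" "adj w y" and c: "conn (V' s) y x" for x y
    using conn_trans[OF conn_edge[of w "insert w (V' s)" y] conn_mono[OF c]] y by auto
  have att_w: "x \<in> attached V' s z" if "conn (insert w (V' s)) w x" "x \<in> V' s" "adj x z" for x
  proof -
    have "x \<noteq> w" using that(2) wX by (auto simp: V's)
    moreover have "z \<in> closed_nbrs (rest V') w" "z \<noteq> w" using tw(2) w zT' by (auto simp: W'_def)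
    ultimately show ?thesis using attachedI[OF opt' s tw(1) that(1), of z] that(3) att_eq(1) by simp
  qed
  have w_R: "\<not> adj w y" if y: "y \<in> R" for y
  proof
    assume wy: "adj w y"
    have sub: "nbrs X z \<subseteq> attached V' s z"
    proof
      fix x assume x: "x \<in> nbrs X z"
      have "conn (insert w (V' s)) w x"
        using to_comp[OF _ wy] R_conn[OF y nbr_z[OF x]] y RV' by blast
      then show "x \<in> attached V' s z"
        using att_w nbr_z[OF x] RV' x by (auto simp: nbrs_def adj_commute[of x z])
    qed
    have "finite (attached V' s z)" using fX by (simp add: attached_def V's)
    then show False using card_mono[OF _ sub] reg[OF z(1)] less' by simp
  qed
  \<comment> \<open>A neighbour in \<open>Q\<close> would bring the vertex \<open>x\<close> of its component into the component of \<open>w\<close>. Then the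
    neighbourhood of \<open>x\<close> outside the class, being an almost clique that meets the remnant \<open>U\<close>, would have
    to be \<open>U\<close>, but \<open>x\<close> is not adjacent to all of \<open>U\<close>.\<close>
  have w_Q: "\<not> adj w y" if y: "y \<in> Q" for y
  proof
    assume wy: "adj w y"
    obtain x U z0 where x: "conn (V s) y x" "U \<in> insert T \<T>" "z0 \<in> U" "adj x z0" "\<exists>t\<in>U. \<not> adj x t"
      using anchor[OF y, folded W_def, folded T_def] by (elim exE conjE) (rule that)
    have "conn (V s \<inter> Q) y x \<and> x \<in> Q" using conn_closed[OF x(1) y] Qcl by blast
    then have xQ: "x \<in> Q" and "conn (V' s) y x"
      using conn_mono[of "V s \<inter> Q" y x "V' s"] Q'V' by (auto simp: Q'_def)
    then have cx: "conn (insert w (V' s)) w x" using to_comp[OF _ wy] y Q'V' by (auto simp: Q'_def)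
    let ?Y1 = "W' - {w}"
    note ne = tight_exchange_nbrs[OF opt' s tw(1) cx, folded W'_def]
    have UY1: "U \<subseteq> ?Y1" using UY(1,5)[OF x(2)] w by (auto simp: W')
    have "nbrs ?Y1 x = U \<or> nbrs ?Y1 x \<inter> U = {}"
      using exchange_nbr_degree[OF opt' s tw(1) cx, folded W'_def] ne UY1 UY(2,3)[OF x(2)] q4
        finite_rest[of V'] nbrs_subset
      by (intro almost_cliques_equal_or_disjoint[of ?Y1]) (auto simp: W'_def)
    moreover have "z0 \<in> nbrs ?Y1 x" using x(3,4) UY1 by (auto simp: nbrs_def)
    ultimately have "nbrs ?Y1 x = U" using x(3) by blast
    then show False using x(5) by (auto simp: nbrs_def)
  qed
  have "chain_state s V' w (insert T \<T>) Q'"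
    unfolding chain_state_def
  proof (intro conjI ballI)
    show "optimal V'" "tight q (rest V') w" "Q' \<subseteq> V' s" by (rule opt' tw(1) Q'V')+
    show "card (attached V' s w) < d s" using less' att_eq by simp
    show "adj x y \<longrightarrow> y \<in> Q'" if "x \<in> Q'" "y \<in> V' s" for x y using Q'cl that by blast
    show "nbrs Q' w = {}" using w_Q w_R by (auto simp: nbrs_def Q'_def)
  next
    fix U assume U: "U \<in> insert T \<T>"
    show "U \<subseteq> rest V' - closed_nbrs (rest V') w"
      using UY(1,4,5)[OF U] tw(2) unfolding W'_def[symmetric] by (auto simp: W')
    show "card U = q" "almost_clique U" using UY[OF U] by auto
  next
    fix U u assume U: "U \<in> insert T \<T>" and u: "u \<in> V' s - Q'"
    have uV: "u \<in> V s" "u \<notin> Q" "\<not> conn X v u"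
      using u conn_refl[of X v] z(2) by (auto simp: V's X_def Q'_def R_def)
    show "\<exists>t\<in>U. \<not> adj u t"
    proof (cases "U = T")
      case True
      show ?thesis
      proof (rule ccontr)
        assume "\<not> ?thesis"
        then have all: "\<And>t. t \<in> T \<Longrightarrow> adj u t" using True by blast
        have "card T \<ge> 4" using cT(1) q4 by simp
        then obtain a b where ua: "universal T a" "universal T b" and ab: "a \<noteq> b"
          using almost_clique_two_universal[OF cT(2)] by blast
        note a = universal_in[OF ua(1)] and b = universal_in[OF ua(2)]
        have ta: "tight q (rest V) a" "closed_nbrs (rest V) a = insert v T"
          using tight_universal[OF opt v, of a] ua(1) D by (auto simp: T_def W_def)
        have aV: "a \<notin> V s" using a TW WV by (auto simp: Y_def)
        have "conn (insert a (V s)) a u"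
          using all[OF a] uV(1) adj_commute[of a u] by (intro conn_edge) auto
        then have "u \<in> attached V s a"
          using attachedI[OF opt s ta(1), of u b] ta(2) ab b all[OF b] uV(1) aV by auto
        then have "u \<in> attached V s v" using ta(2) D by (simp add: attached_def W_def)
        then have "adj v u" using attached_subset_nbrs[OF v] by (auto simp: nbrs_def)
        then have "conn X v u" using uV(1) by (intro conn_edge) (auto simp: X_def)
        then show False using uV(3) by simp
      qed
    next
      case False
      then show ?thesis using full[of U u] U uV by auto
    qed
  next
    fix y assume y: "y \<in> Q'"
    show "\<exists>x U z'. conn (V' s) y x \<and> U \<in> insert (nbrs (rest V') w) (insert T \<T>) \<and> z' \<in> U \<and>
      adj x z' \<and> (\<exists>t\<in>U. \<not> adj x t)"
    proof (cases "y \<in> Q")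
      case True
      obtain x U z0 where x: "conn (V s) y x" "U \<in> insert T \<T>" "z0 \<in> U" "adj x z0" "\<exists>t\<in>U. \<not> adj x t"
        using anchor[OF True, folded W_def, folded T_def] by (elim exE conjE) (rule that)
      have "conn (V s \<inter> Q) y x" using conn_closed[OF x(1) True] Qcl by blast
      then have "conn (V' s) y x" using conn_mono[of "V s \<inter> Q" y x "V' s"] Q'V' by (auto simp: Q'_def)
      then show ?thesis using x by blast
    next
      case False
      then have yR: "y \<in> R" using y by (simp add: Q'_def)
      have "card (nbrs X z) > 0" using reg[OF z(1)] less' by simp
      then obtain x where x: "x \<in> nbrs X z" by (metis all_not_in_conv card.empty less_nat_zero_code)
      have xR: "x \<in> R" using nbr_z[OF x] .
      have xz: "adj x z" using x by (simp add: nbrs_def adj_commute[of x z])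
      \<comment> \<open>The second universal vertex \<open>w2\<close> is needed here: if \<open>x\<close> were adjacent to it, \<open>x\<close> would be attached
        and so adjacent to \<open>w\<close>.\<close>
      have "\<exists>t\<in>nbrs W' w. \<not> adj x t"
      proof (rule ccontr)
        assume "\<not> ?thesis"
        moreover have "w2 \<in> nbrs W' w" using nw w2 ww2 by auto
        ultimately have xw2: "adj x w2" by blast
        have xV: "x \<in> V' s" using xR RV' by blast
        have "w2 \<notin> X" using w2 T'(1) WV by (auto simp: X_def Y_def)
        then have "x \<noteq> w2" using xV by (auto simp: V's)
        moreover have "z \<noteq> w2" using w2 zT' by auto
        moreover have "conn (insert w2 (V' s)) w2 x"
          using xV xw2 adj_commute[of x w2] by (intro conn_edge) auto
        ultimately have "x \<in> attached V' s w2"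
          using attachedI[OF opt' s tw2(1), of x z] tw2(2) xz by (simp add: W'_def)
        then have "x \<in> attached V' s w" using att_eq by simp
        then have "adj w x" using attached_subset_nbrs[OF tw(1)] by (auto simp: nbrs_def)
        then show False using w_R[OF xR] by simp
      qed
      moreover have "z \<in> nbrs W' w" using nw w zT' by auto
      moreover have "conn (V' s) y x" using R_conn[OF yR xR] .
      ultimately show ?thesis using xz unfolding W'_def by blast
    qed
  qed
  then show ?thesis using T_new unfolding T_def W_def by blast
qed

text \<open>The vertex set is finite, whereas every step of the chain adds a new remnant.\<close>

theorem ex_partition_without_tight:
  "\<exists>V. valid V \<and> (\<forall>S\<subseteq>VV. free r S \<longrightarrow> card S \<le> card (V r)) \<and>
     (\<forall>x\<in>rest V. card (nbrs (rest V) x) \<le> q \<and> \<not> tight q (rest V) x)"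
proof -
  obtain V where opt: "optimal V" using ex_optimal by blast
  have "\<not> tight q (rest V) v" for v
  proof
    assume v: "tight q (rest V) v"
    obtain s where s: "s \<in> I" "card (attached V s v) < d s"
      using ex_colour_not_all_attached[OF opt v] by blast
    have "\<exists>V v \<T> Q. chain_state s V v \<T> Q \<and> finite \<T> \<and> card \<T> = n" for n
    proof (induction n)
      case 0
      have "chain_state s V v {} {}" using opt v s(2) by (simp add: chain_state_def nbrs_def)
      then show ?case by (metis card.empty finite.emptyI)
    next
      case (Suc n)
      then obtain V v \<T> Q where st: "chain_state s V v \<T> Q" "finite \<T>" "card \<T> = n" by blast
      then have "card (insert (nbrs (rest V) v) \<T>) = Suc n" using chain_step[OF s(1) st(1)] by simp
      then show ?case using chain_step[OF s(1) st(1)] st(2) by (metis finite_insert)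
    qed
    then obtain V v \<T> Q where st: "chain_state s V v \<T> Q" "finite \<T>" "card \<T> = Suc (card (Pow VV))"
      by blast
    have "\<T> \<subseteq> Pow VV" using st(1) by (auto simp: chain_state_def rest_def)
    then have "card \<T> \<le> card (Pow VV)" using finite_VV by (intro card_mono) auto
    then show False using st(3) by simp
  qed
  moreover have "card S \<le> card (V r)" if S: "S \<subseteq> VV" "free r S" for S
  proof -
    have "valid (\<lambda>s. if s = r then S else {})"
      using S free_empty by (auto simp: valid_def disjoint_family_on_def)
    then show ?thesis using optimalD(2)[OF opt] unfolding size_optimal_def by fastforce
  qed
  moreover have "card (nbrs (rest V) x) \<le> q" if "x \<in> rest V" for x
    using rest_degree_le[OF optimalD(2)[OF opt] that] .
  ultimately show ?thesis using optimalD(3)[OF opt] by blast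
qed

end

section \<open>Partitions of digraphs\<close>

context simple_adjacency begin

text \<open>As \<open>v\<close> has at most \<open>q\<close> neighbours, the two cliques have exactly \<open>q + 1\<close> vertices together, so each has one
vertex outside the other, and only these two can be nonadjacent.\<close>

lemma tight_of_meeting_cliques:
  assumes W: "finite W" "A \<subseteq> W" "B \<subseteq> W" and AB: "clique A" "clique B" "card A = q" "card B = q" "A \<noteq> B"
    and v: "v \<in> A" "v \<in> B" and deg: "card (nbrs W v) \<le> q"
  shows "tight q W v"
proof -
  have fin: "finite A" "finite B" using W finite_subset by auto
  have "\<not> B \<subseteq> A" using AB card_subset_eq[OF fin(1)] by auto
  then have "A \<subset> A \<union> B" by blast
  then have "q < card (A \<union> B)" using psubset_card_mono[of "A \<union> B" A] fin AB(3) by simp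
  moreover have sub: "A \<union> B - {v} \<subseteq> nbrs W v" using v AB(1,2) W(2,3) by (auto simp: clique_def nbrs_def)
  moreover have fn: "finite (nbrs W v)" using W(1) nbrs_subset finite_subset by blast
  moreover have cv: "card (A \<union> B - {v}) = card (A \<union> B) - 1" using v fin by simp
  ultimately have "card (A \<union> B) = q + 1" and eq: "nbrs W v = A \<union> B - {v}"
    using deg card_mono[OF fn sub] card_seteq[OF fn sub] by auto
  then have c: "card (nbrs W v) = q" using cv by simp
  have cu: "card (A \<union> B) = q + 1" by fact
  have "card (A - B) = 1"
    using card_Diff_subset[OF fin(2), of "A \<union> B"] cu AB(4) by (simp add: Un_Diff)
  then obtain a where a: "A - B = {a}" by (metis card_1_singletonE)
  have "card (B - A) = 1"
    using card_Diff_subset[OF fin(1), of "A \<union> B"] cu AB(3) by (simp add: Un_Diff)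
  then obtain b where b: "B - A = {b}" by (metis card_1_singletonE)
  have "{x, y} = {a, b}" if xy: "x \<in> nbrs W v" "y \<in> nbrs W v" "x \<noteq> y" "\<not> adj x y" for x y
  proof -
    have "x \<in> A \<union> B" "y \<in> A \<union> B" using xy eq by auto
    moreover have "\<not> (x \<in> A \<and> y \<in> A)" "\<not> (x \<in> B \<and> y \<in> B)"
      using xy AB(1,2) unfolding clique_def by blast+
    ultimately have "(x \<in> A - B \<and> y \<in> B - A) \<or> (x \<in> B - A \<and> y \<in> A - B)" by blast
    then show ?thesis using a b by auto
  qed
  then have "almost_clique (nbrs W v)"
    unfolding almost_clique_def by (intro exI[of _ "{a, b}"]) blast
  then show ?thesis using c v(1) W(2) by (auto simp: tight_def)
qed

end

lemma (in graph) simple_adjacency: "simple_adjacency (dominates G)"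
proof
  show "y \<rightarrow>\<^bsub>G\<^esub> x" if "x \<rightarrow>\<^bsub>G\<^esub> y" for x y
    using that sym_arcs by (auto simp: symmetric_def dest: symD)
  show "\<not> x \<rightarrow>\<^bsub>G\<^esub> x" for x using no_loops by (auto simp: arcs_ends_conv)
qed

lemma (in graph) out_degree_induce:
  assumes "x \<in> S"
  shows "out_degree (G \<restriction> S) x = card (simple_adjacency.nbrs (dominates G) S x)"
proof -
  interpret adjacency: simple_adjacency "dominates G" by (rule simple_adjacency)
  have "bij_betw (head G) (out_arcs (G \<restriction> S) x) (adjacency.nbrs S x)"
    unfolding bij_betw_def
  proof
    show "inj_on (head G) (out_arcs (G \<restriction> S) x)"
      by (rule inj_onI) (auto simp: out_arcs_def arc_to_ends_def intro!: no_multi_arcs)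
    show "head G ` out_arcs (G \<restriction> S) x = adjacency.nbrs S x"
    proof (intro equalityI subsetI)
      fix y assume "y \<in> head G ` out_arcs (G \<restriction> S) x"
      then show "y \<in> adjacency.nbrs S x"
        unfolding adjacency.nbrs_def by (auto simp: out_arcs_def arcs_ends_conv)
    next
      fix y assume "y \<in> adjacency.nbrs S x"
      then obtain e where "e \<in> arcs G" "tail G e = x" "head G e = y" "y \<in> S"
        unfolding adjacency.nbrs_def by (auto simp: arcs_ends_conv)
      then show "y \<in> head G ` out_arcs (G \<restriction> S) x"
        using assms by (auto simp: out_arcs_def)
    qed
  qed
  then show ?thesis unfolding out_degree_def by (rule bij_betw_same_card)
qed

lemma (in graph) degree_le_max_degree:
  assumes "x \<in> verts G"
  shows "card (simple_adjacency.nbrs (dominates G) (verts G) x) \<le> max_degree G"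
proof -
  have "out_arcs (G \<restriction> verts G) x = out_arcs G x" by (auto simp: out_arcs_def)
  then have "out_degree G x = card (simple_adjacency.nbrs (dominates G) (verts G) x)"
    using out_degree_induce[OF assms] by (simp add: out_degree_def)
  moreover have "out_degree G x \<le> max_degree G"
    using assms by (auto simp: max_degree_def)
  ultimately show ?thesis by simp
qed

lemma (in graph) max_degree_induce_le:
  assumes "finite S" "\<And>x. x \<in> S \<Longrightarrow> card (simple_adjacency.nbrs (dominates G) S x) \<le> m"
  shows "max_degree (G \<restriction> S) \<le> m"
  using assms out_degree_induce by (auto simp: max_degree_def)

lemma (in wf_digraph) family_free_induce_subset:
  assumes "family_free \<G> (G \<restriction> S)" "S' \<subseteq> S"
  shows "family_free \<G> (G \<restriction> S')"
proof -
  have "subgraph (G \<restriction> S') (G \<restriction> S)"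
    using assms(2) wellformed_induce_subgraph by (auto simp: subgraph_def compatible_def)
  then show ?thesis using assms(1) subgraph_trans unfolding family_free_def graph_free_def by blast
qed

lemma min_degree_le:
  "finite (verts G) \<Longrightarrow> u \<in> verts G \<Longrightarrow> min_degree G \<le> out_degree G u"
  by (auto simp: min_degree_def)

text \<open>In a copy of a forbidden graph that uses the new vertex \<open>x\<close>, this vertex would have degree at least \<open>m\<close>.\<close>

lemma (in graph) family_free_insert:
  assumes free: "family_free \<G> (G \<restriction> S)"
    and \<G>: "\<And>F. F \<in> \<G> \<Longrightarrow> graph F \<and> m \<le> min_degree F"
    and less: "card (simple_adjacency.nbrs (dominates G) S x) < m"
  shows "family_free \<G> (G \<restriction> insert x S)"
  unfolding family_free_def graph_free_def
proof (intro ballI notI)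
  interpret adjacency: simple_adjacency "dominates G" by (rule simple_adjacency)
  fix F assume F: "F \<in> \<G>" and "\<exists>H'. subgraph H' (G \<restriction> insert x S) \<and> digraph_iso F H'"
  then obtain f where f: "pre_digraph.digraph_isomorphism F f"
    and sub: "subgraph (app_iso f F) (G \<restriction> insert x S)" by (auto simp: digraph_iso_def)
  interpret F: graph F using \<G>[OF F] by blast
  show False
  proof (cases "x \<in> verts (app_iso f F)")
    case True
    then obtain u where u: "u \<in> verts F" "x = iso_verts f u" by auto
    have "m \<le> out_degree F u"
      using \<G>[OF F] min_degree_le[OF F.finite_verts u(1)] by (meson le_trans)
    also have "\<dots> = out_degree (app_iso f F) x"
      using F.out_degree_app_iso_eq[OF f u(1)] u(2) by simp
    also have "\<dots> \<le> out_degree (G \<restriction> insert x S) x"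
      unfolding out_degree_def
    proof (rule card_mono)
      show "finite (out_arcs (G \<restriction> insert x S) x)"
        by (rule finite_subset[OF _ finite_arcs]) (auto simp: out_arcs_def)
      have "arcs (app_iso f F) \<subseteq> arcs (G \<restriction> insert x S)" "tail (app_iso f F) = tail (G \<restriction> insert x S)"
        using sub by (auto simp: subgraph_def compatible_def)
      then show "out_arcs (app_iso f F) x \<subseteq> out_arcs (G \<restriction> insert x S) x"
        unfolding out_arcs_def by (metis (no_types, lifting) Collect_mono subset_eq)
    qed
    also have "\<dots> = card (adjacency.nbrs S x)"
      using out_degree_induce[of x "insert x S"] by (simp add: adjacency.nbrs_insert_self)
    finally show False using less by simp
  next
    case False
    have wf: "wf_digraph (app_iso f F)" using sub by (simp add: subgraph_def)
    have V: "verts (app_iso f F) \<subseteq> S" using sub False by (auto simp: subgraph_def)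
    have "arcs (app_iso f F) \<subseteq> arcs (G \<restriction> S)"
    proof
      fix e assume e: "e \<in> arcs (app_iso f F)"
      have "tail (app_iso f F) e \<in> S" "head (app_iso f F) e \<in> S"
        using wf_digraph.tail_in_verts[OF wf e] wf_digraph.head_in_verts[OF wf e] V by blast+
      moreover have "tail (app_iso f F) = tail G" "head (app_iso f F) = head G" "e \<in> arcs G"
        using sub e by (auto simp: subgraph_def compatible_def)
      ultimately show "e \<in> arcs (G \<restriction> S)" by simp
    qed
    then have "subgraph (app_iso f F) (G \<restriction> S)"
      using sub V wf wellformed_induce_subgraph by (auto simp: subgraph_def compatible_def)
    then show False using free F f unfolding family_free_def graph_free_def digraph_iso_def by blast
  qed
qed

text \<open>The null graph has minimum degree 0 by definition, so it is not among the forbidden graphs.\<close>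

lemma family_free_induce_empty:
  assumes "\<And>F. F \<in> \<G> \<Longrightarrow> 0 < min_degree F"
  shows "family_free \<G> (G \<restriction> {})"
  unfolding family_free_def graph_free_def
proof (intro ballI notI)
  fix F assume F: "F \<in> \<G>" and "\<exists>H'. subgraph H' (G \<restriction> {}) \<and> digraph_iso F H'"
  then have "verts F = {}" by (auto simp: digraph_iso_def subgraph_def)
  then show False using assms[OF F] by (simp add: min_degree_def)
qed

text \<open>The vertices are numbered such that \<open>0\<close> and \<open>1\<close> become the ends of the missing edge, or any two vertices
if no edge is missing.\<close>

lemma (in graph) almost_clique_contains_complete_minus_edge:
  assumes B: "B \<subseteq> verts G" "card B \<ge> 2" and ac: "simple_adjacency.almost_clique (dominates G) B"
  shows "\<not> graph_free (with_proj (complete_graph_minus_edge (card B))) G"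
proof -
  interpret adjacency: simple_adjacency "dominates G" by (rule simple_adjacency)
  let ?n = "card B"
  let ?K = "with_proj (complete_graph_minus_edge ?n)"
  have fB: "finite B" using B finite_subset[OF B(1) finite_verts] by simp
  obtain a b where ab: "a \<in> B" "b \<in> B" "a \<noteq> b"
    and adj: "\<And>x y. \<lbrakk>x \<in> B; y \<in> B; x \<noteq> y; {x, y} \<noteq> {a, b}\<rbrakk> \<Longrightarrow> x \<rightarrow>\<^bsub>G\<^esub> y"
  proof (cases "adjacency.clique B")
    case True
    obtain a b where "a \<in> B" "b \<in> B" "a \<noteq> b"
      using B(2) card_le_Suc0_iff_eq[OF fB] by (metis not_less_eq_eq numeral_2_eq_2)
    then show ?thesis using that True by (auto simp: adjacency.clique_def)
  next
    case False
    then obtain a b where ab: "a \<in> B" "b \<in> B" "a \<noteq> b" "\<not> a \<rightarrow>\<^bsub>G\<^esub> b"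
      by (auto simp: adjacency.clique_def)
    then show ?thesis using that[of a b] adjacency.almost_clique_nonedge_unique[OF ac ab] by metis
  qed
  have "card (B - {a, b}) = card {2..<?n}" using ab fB by (simp add: card_Diff_subset)
  then obtain g where g: "bij_betw g {2..<?n} (B - {a, b})"
    using finite_same_card_bij[of "{2..<?n}" "B - {a, b}"] fB by auto
  define f where "f i = (if i = 0 then a else if i = 1 then b else g i)" for i :: nat
  have n: "{..<?n} = insert 0 (insert 1 {2..<?n})" using B(2) by auto
  have fim: "f ` {..<?n} = B"
  proof -
    have "f ` {2..<?n} = g ` {2..<?n}" by (rule image_cong) (auto simp: f_def)
    also have "\<dots> = B - {a, b}" using g by (rule bij_betw_imp_surj_on)
    finally have "f ` {..<?n} = insert (f 0) (insert (f 1) (B - {a, b}))" by (simp add: n)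
    also have "\<dots> = B" using ab by (auto simp: f_def)
    finally show ?thesis .
  qed
  have inj: "inj_on f {..<?n}"
    by (rule eq_card_imp_inj_on) (simp_all add: fim)
  have arc: "\<exists>e\<in>arcs G. tail G e = f i \<and> head G e = f j" if ij: "(i, j) \<in> arcs ?K" for i j
  proof -
    have h: "i < ?n" "j < ?n" "i \<noteq> j" "(i, j) \<noteq> (0, 1)" "(i, j) \<noteq> (1, 0)"
      using ij by (auto simp: complete_graph_minus_edge_def complete_graph_def)
    then have "f i \<noteq> f j" using inj by (auto simp: inj_on_def)
    moreover have "{f i, f j} \<noteq> {f 0, f 1}"
    proof
      assume "{f i, f j} = {f 0, f 1}"
      then consider "f i = f 0" "f j = f 1" | "f i = f 1" "f j = f 0" by (auto simp: doubleton_eq_iff)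
      moreover have injf: "i' = j'" if "i' < ?n" "j' < ?n" "f i' = f j'" for i' j'
        using inj that by (auto simp: inj_on_def)
      moreover have lt: "0 < ?n" "1 < ?n" using B(2) by auto
      ultimately show False
      proof cases
        case 1
        then show ?thesis using injf[OF h(1) lt(1)] injf[OF h(2) lt(2)] h(4) by simp
      next
        case 2
        then show ?thesis using injf[OF h(1) lt(2)] injf[OF h(2) lt(1)] h(5) by simp
      qed
    qed
    moreover have "f i \<in> B" "f j \<in> B" using fim h by auto
    ultimately have "f i \<rightarrow>\<^bsub>G\<^esub> f j" using adj by (auto simp: f_def)
    then show ?thesis by (auto simp: arcs_ends_conv)
  qed
  define \<phi> where "\<phi> ij = (SOME e. e \<in> arcs G \<and> tail G e = f (fst ij) \<and> head G e = f (snd ij))" for ij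
  have \<phi>: "\<phi> ij \<in> arcs G \<and> tail G (\<phi> ij) = f (fst ij) \<and> head G (\<phi> ij) = f (snd ij)"
    if "ij \<in> arcs ?K" for ij
    unfolding \<phi>_def by (rule someI_ex) (use arc[of "fst ij" "snd ij"] that in auto)
  define hom where "hom = \<lparr>iso_verts = f, iso_arcs = \<phi>, iso_head = head G, iso_tail = tail G\<rparr>"
  have wfK: "wf_digraph ?K"
    by unfold_locales (auto simp: complete_graph_minus_edge_def complete_graph_def)
  have vK: "verts ?K = {..<?n}" by (simp add: complete_graph_minus_edge_def)
  have endsK: "fst ij < ?n" "snd ij < ?n" if "ij \<in> arcs ?K" for ij
    using that by (auto simp: complete_graph_minus_edge_def complete_graph_def)
  have iso: "pre_digraph.digraph_isomorphism ?K hom"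
    unfolding pre_digraph.digraph_isomorphism_def
  proof (intro conjI ballI)
    show "wf_digraph ?K" by (rule wfK)
    show "inj_on (iso_verts hom) (verts ?K)" using inj vK by (simp add: hom_def)
    show "inj_on (iso_arcs hom) (arcs ?K)"
    proof (rule inj_onI)
      fix x y assume xy: "x \<in> arcs ?K" "y \<in> arcs ?K" "iso_arcs hom x = iso_arcs hom y"
      then have "\<phi> x = \<phi> y" by (simp add: hom_def)
      then have "f (fst x) = f (fst y)" "f (snd x) = f (snd y)" using \<phi>[OF xy(1)] \<phi>[OF xy(2)] by auto
      then have "fst x = fst y" "snd x = snd y" using inj endsK[OF xy(1)] endsK[OF xy(2)]
        by (auto simp: inj_on_def)
      then show "x = y" by (simp add: prod_eq_iff)
    qed
  next
    fix x assume x: "x \<in> arcs ?K"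
    show "iso_verts hom (tail ?K x) = iso_tail hom (iso_arcs hom x)"
      "iso_verts hom (head ?K x) = iso_head hom (iso_arcs hom x)"
      using \<phi>[OF x] by (simp_all add: hom_def)
  qed
  have "subgraph (app_iso hom ?K) G"
    unfolding subgraph_def
  proof (intro conjI)
    show "verts (app_iso hom ?K) \<subseteq> verts G" using fim B(1) vK by (simp add: hom_def)
    show "arcs (app_iso hom ?K) \<subseteq> arcs G"
    proof
      fix e assume "e \<in> arcs (app_iso hom ?K)"
      then obtain ij where "ij \<in> arcs ?K" "e = \<phi> ij" by (auto simp: hom_def)
      then show "e \<in> arcs G" using \<phi> by blast
    qed
    show "wf_digraph (app_iso hom ?K)" using wf_digraph.wf_digraphI_app_iso[OF wfK iso] .
    show "compatible G (app_iso hom ?K)" by (simp add: compatible_def hom_def)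
  qed (rule wf_digraph)
  then show ?thesis using iso unfolding graph_free_def digraph_iso_def by blast
qed

text \<open>A complete subgraph is determined by its vertices because there are no parallel arcs.\<close>

lemma (in graph) clique_subgraph_arcs:
  assumes C: "subgraph C (G \<restriction> S)" "K\<^bsub>q\<^esub> C"
  shows "arcs C = {e \<in> arcs G. tail G e \<in> verts C \<and> head G e \<in> verts C}"
proof -
  have sub: "arcs C \<subseteq> arcs G" "tail C = tail G" "head C = head G" "wf_digraph C"
    using C(1) by (auto simp: subgraph_def compatible_def)
  show ?thesis
  proof (intro equalityI subsetI)
    fix e assume e: "e \<in> arcs C"
    then show "e \<in> {e \<in> arcs G. tail G e \<in> verts C \<and> head G e \<in> verts C}"
      using wf_digraph.tail_in_verts[OF sub(4) e] wf_digraph.head_in_verts[OF sub(4) e] sub by auto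
  next
    fix e assume e: "e \<in> {e \<in> arcs G. tail G e \<in> verts C \<and> head G e \<in> verts C}"
    then have "(tail G e, head G e) \<in> arcs_ends C"
      using C(2) no_loops by (auto simp: complete_digraph_def)
    then obtain e' where e': "e' \<in> arcs C" "tail G e' = tail G e" "head G e' = head G e"
      using sub(2,3) by (auto simp: arcs_ends_conv)
    then have "e' = e" using no_multi_arcs[of e' e] e sub(1) by (auto simp: arc_to_ends_def)
    then show "e \<in> arcs C" using e' by simp
  qed
qed

lemma (in graph) cliques_disjoint_if_not_tight:
  assumes fin: "finite S"
    and deg: "\<And>x. x \<in> S \<Longrightarrow> card (simple_adjacency.nbrs (dominates G) S x) \<le> q"
    and not_tight: "\<And>x. x \<in> S \<Longrightarrow> \<not> simple_adjacency.tight (dominates G) q S x"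
  shows "cliques_disjoint q (G \<restriction> S)"
  unfolding cliques_disjoint_def
proof (intro ballI impI, rule ccontr)
  interpret adjacency: simple_adjacency "dominates G" by (rule simple_adjacency)
  fix C D assume CD: "C \<in> cliques q (G \<restriction> S)" "D \<in> cliques q (G \<restriction> S)" "C \<noteq> D" "verts C \<inter> verts D \<noteq> {}"
  have q: "verts C' \<subseteq> S \<and> card (verts C') = q \<and> adjacency.clique (verts C')
    \<and> arcs C' = {e \<in> arcs G. tail G e \<in> verts C' \<and> head G e \<in> verts C'}
    \<and> tail C' = tail G \<and> head C' = head G"
    if C': "C' \<in> cliques q (G \<restriction> S)" for C'
  proof -
    have s: "subgraph C' (G \<restriction> S)" "K\<^bsub>q\<^esub> C'" using C' by (auto simp: cliques_def)
    have t: "tail C' = tail G" "head C' = head G" "arcs C' \<subseteq> arcs G"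
      using s(1) by (auto simp: subgraph_def compatible_def)
    have "arcs_ends C' \<subseteq> arcs_ends G" using t by (auto simp: arcs_ends_conv)
    then have "adjacency.clique (verts C')"
      using s(2) by (auto simp: complete_digraph_def adjacency.clique_def)
    then show ?thesis using s clique_subgraph_arcs[OF s] t by (auto simp: subgraph_def complete_digraph_def)
  qed
  obtain v where v: "v \<in> verts C" "v \<in> verts D" using CD(4) by blast
  have "verts C \<noteq> verts D"
  proof
    assume "verts C = verts D"
    then have "C = D" using q[OF CD(1)] q[OF CD(2)] by (intro pre_digraph.equality) auto
    then show False using CD(3) by simp
  qed
  then have "adjacency.tight q S v"
    using q[OF CD(1)] q[OF CD(2)] v fin deg
    by (intro adjacency.tight_of_meeting_cliques[of S "verts C" "verts D"]) auto
  then show False using not_tight q[OF CD(1)] v(1) by blast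
qed

theorem corollary1p2:
  fixes H :: "('a, 'b) pre_digraph"
    and k :: nat
    and p :: "nat \<Rightarrow> nat"
    and \<G> :: "nat \<Rightarrow> ('c, 'd) pre_digraph set"
  assumes "graph H"
    and "connected H"
    and "max_degree H \<ge> 5"
    and "k \<ge> 2"
    and "antimono_on {1..k-1} p"
    and "p (k - 1) \<ge> 2"
    and "p k \<ge> 4"
    and "(\<Sum>i=1..k. p i) = max_degree H - 1 + k"
    and "\<forall>i\<in>{1..k-1}. \<forall>G\<in>\<G> i. graph G \<and> min_degree G \<ge> p i - 1"
    and "graph_free (with_proj (complete_graph_minus_edge (max_degree H + 1))) H"
  shows "\<exists>V :: nat \<Rightarrow> 'a set.
           (\<Union>i\<in>{1..k}. V i) = verts H \<and>
           disjoint_family_on V {1..k} \<and>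
           maximum_family_free_induced (\<G> 1) H (V 1) \<and>
           (\<forall>i\<in>{2..k-1}. family_free (\<G> i) (H \<restriction> V i)) \<and>
           max_degree (H \<restriction> V k) \<le> p k \<and>
           (graph_free (with_proj (complete_graph (p k))) (H \<restriction> V k) \<or>
            cliques_disjoint (p k) (H \<restriction> V k))"
proof -
  interpret H: graph H by fact
  interpret adjacency: simple_adjacency "dominates H" by (rule H.simple_adjacency)
  let ?I = "{1..k-1}"
  have p2: "p i \<ge> 2" if "i \<in> ?I" for i
    using assms(4-6) that unfolding monotone_on_def by (metis (no_types, lifting) atLeastAtMost_iff
      diff_is_0_eq le_trans nat_le_linear not_numeral_le_zero order_refl)
  have k: "{1..k} = insert k ?I" using assms(4) by auto
  then have "(\<Sum>i=1..k. p i) = p k + (\<Sum>i\<in>?I. p i)" using assms(4) by simp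
  moreover have "(\<Sum>i\<in>?I. p i) = (\<Sum>i\<in>?I. p i - 1) + (k - 1)"
  proof -
    have "(\<Sum>i\<in>?I. p i) = (\<Sum>i\<in>?I. (p i - 1) + 1)" by (rule sum.cong) (use p2 in fastforce)+
    also have "\<dots> = (\<Sum>i\<in>?I. p i - 1) + (k - 1)" by (subst sum.distrib) simp
    finally show ?thesis .
  qed
  ultimately have sum: "p k + (\<Sum>i\<in>?I. p i - 1) = max_degree H"
    using assms(3,4,8) by linarith
  interpret free_partitions "dominates H" "verts H" ?I 1 "\<lambda>i. p i - 1"
    "\<lambda>i S. family_free (\<G> i) (H \<restriction> S)" "p k"
  proof
    show "finite (verts H)" "finite ?I" "1 \<in> ?I" "p k \<ge> 4" using assms(4,7) by auto
  next
    fix s assume s: "s \<in> ?I"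
    show "family_free (\<G> s) (H \<restriction> {})"
      using assms(9) s p2[OF s] by (intro family_free_induce_empty) fastforce
    show "family_free (\<G> s) (H \<restriction> S')" if "family_free (\<G> s) (H \<restriction> S)" "S' \<subseteq> S" for S S'
      using H.family_free_induce_subset that .
    show "family_free (\<G> s) (H \<restriction> insert x S)"
      if "family_free (\<G> s) (H \<restriction> S)" "card (adjacency.nbrs S x) < p s - 1" for S x
      using H.family_free_insert[OF that(1) _ that(2)] assms(9) s by blast
  next
    show "card (adjacency.nbrs (verts H) x) \<le> p k + (\<Sum>s\<in>?I. p s - 1)" if "x \<in> verts H" for x
      using H.degree_le_max_degree[OF that] sum by simp
    show "\<not> adjacency.almost_clique B" if "B \<subseteq> verts H" "card B = p k + (\<Sum>s\<in>?I. p s - 1) + 1" for B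
      using H.almost_clique_contains_complete_minus_edge[of B] that assms(3,10) sum by auto
  qed
  obtain V where V: "valid V" "\<And>S. S \<subseteq> verts H \<Longrightarrow> family_free (\<G> 1) (H \<restriction> S) \<Longrightarrow> card S \<le> card (V 1)"
    and R: "\<And>x. x \<in> rest V \<Longrightarrow> card (adjacency.nbrs (rest V) x) \<le> p k \<and> \<not> adjacency.tight (p k) (rest V) x"
    using ex_partition_without_tight by blast
  define V' where "V' = V(k := rest V)"
  have V'I: "V' i = V i" if "i \<in> ?I" for i using that assms(4) by (auto simp: V'_def)
  have V'k: "V' k = rest V" by (simp add: V'_def)
  have valid: "disjoint_family_on V ?I" "\<And>i. i \<in> ?I \<Longrightarrow> V i \<subseteq> verts H \<and> family_free (\<G> i) (H \<restriction> V i)"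
    using V(1) unfolding valid_def by blast+
  have "(\<Union>i\<in>{1..k}. V' i) = rest V \<union> (\<Union>i\<in>?I. V i)" unfolding k using V'I V'k by auto
  also have "\<dots> = verts H" using valid(2) unfolding rest_def by blast
  finally have "(\<Union>i\<in>{1..k}. V' i) = verts H" .
  moreover have "disjoint_family_on V' {1..k}"
  proof -
    have apart: "rest V \<inter> V i = {}" if "i \<in> ?I" for i using that unfolding rest_def by blast
    show ?thesis unfolding disjoint_family_on_def k
    proof (intro ballI impI)
      fix i j assume ij: "i \<in> insert k ?I" "j \<in> insert k ?I" "i \<noteq> j"
      show "V' i \<inter> V' j = {}"
      proof (cases "i = k \<or> j = k")
        case True
        then show ?thesis using ij apart V'I V'k by (metis Int_commute insertE)
      next
        case False
        then show ?thesis using ij valid(1) V'I by (auto simp: disjoint_family_on_def)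
      qed
    qed
  qed
  moreover have "maximum_family_free_induced (\<G> 1) H (V' 1)"
    using V(2) valid(2)[of 1] V'I[of 1] assms(4) by (auto simp: maximum_family_free_induced_def)
  moreover have "\<forall>i\<in>{2..k-1}. family_free (\<G> i) (H \<restriction> V' i)"
    using valid(2) V'I by simp
  moreover have "max_degree (H \<restriction> V' k) \<le> p k"
    unfolding V'k using R finite_rest by (intro H.max_degree_induce_le) auto
  moreover have "cliques_disjoint (p k) (H \<restriction> V' k)"
    unfolding V'k using R finite_rest by (intro H.cliques_disjoint_if_not_tight) auto
  ultimately show ?thesis by blast
qed

end
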